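(* Let $X$ be a smooth and strictly convex real normed space of dimension $3$, and let $G$ be (the graph of) a triangulation of the sphere. Then $G$ is independent in $X$.
   Context: A triangulation of the sphere is understood in the standard sense: $G$ is the $1$-skeleton of a finite simplicial complex homeomorphic to the $2$-sphere; in particular $G$ is a finite simple graph. Let $X$ be a finite dimensional real normed space with dual $X^*$. A linear functional $f:X\to\mathbb{R}$ supports a non-zero point $x_0\in X$ if $f(x_0)=\|x_0\|^2$ and $\sup_{\|x\|\le1}|f(x)|=\|x_0\|$. If exactly one linear functional supports $x_0$ then $x_0$ is called smooth and $\varphi_{x_0}$ denotes this functional. $X$ is smooth if every non-zero point is smooth, and strictly convex if $\|x+y\|<\|x\|+\|y\|$ whenever $x,y$ are non-zero and $x$ is not a scalar multiple of $y$ (equivalently, if the closed unit ball of $X$ is strictly convex). A placement of $G=(V,E)$ in $X$ is a point $p=(p_v)_{v\in V}\in X^V$ with $p_v\neq p_w$ for each $vw\in E$. Fix a basis $b_1,\dots,b_d$ of $X$. The rigidity matrix $R(G,p)$ (for $p$ with all $p_v-p_w$, $vw\in E$, smooth) has rows indexed by $E$ and columns indexed by $V\times\{1,\dots,d\}$; for $e=vw$ its $(e,(v,k))$ entry is $\varphi_{p_v-p_w}(b_k)$, its $(e,(w,k))$ entry is $\varphi_{p_w-p_v}(b_k)=-\varphi_{p_v-p_w}(b_k)$, and the remaining entries of row $e$ are $0$. $(G,p)$ is independent if the rows of $R(G,p)$ are linearly independent; $G$ is independent in $X$ if $(G,p)$ is independent for some such placement $p$. *)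

theory Defs
  imports "HOL-Analysis.Analysis"
begin

section \<open>Smooth and strictly convex normed spaces\<close>

text \<open>
  The real-valued supremum below is only meaningful for functionals that are bounded on the unit
  ball, hence \<open>bounded_linear\<close>. On a finite-dimensional space every linear functional is bounded.
\<close>

definition supports :: "('x::real_normed_vector \<Rightarrow> real) \<Rightarrow> 'x \<Rightarrow> bool" where
  "supports f x0 \<longleftrightarrow>
     bounded_linear f \<and> f x0 = (norm x0)\<^sup>2 \<and> (SUP x\<in>cball 0 1. \<bar>f x\<bar>) = norm x0"

definition smooth_point :: "'x::real_normed_vector \<Rightarrow> bool" where
  "smooth_point x0 \<longleftrightarrow> x0 \<noteq> 0 \<and> (\<exists>!f. supports f x0)"

definition support_functional :: "'x::real_normed_vector \<Rightarrow> 'x \<Rightarrow> real" where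
  "support_functional x0 = (THE f. supports f x0)"

definition smooth_space :: "'x::real_normed_vector itself \<Rightarrow> bool" where
  "smooth_space _ \<longleftrightarrow> (\<forall>x::'x. x \<noteq> 0 \<longrightarrow> smooth_point x)"

definition strictly_convex_space :: "'x::real_normed_vector itself \<Rightarrow> bool" where
  "strictly_convex_space _ \<longleftrightarrow>
     (\<forall>x y::'x. x \<noteq> 0 \<and> y \<noteq> 0 \<and> (\<nexists>c. x = c *\<^sub>R y) \<longrightarrow> norm (x + y) < norm x + norm y)"


section \<open>Frameworks and independence\<close>

text \<open>
  A graph is given by its vertex set \<open>V\<close> and its set \<open>E\<close> of two-element edges. Placements are total
  functions on the vertex type; their values outside \<open>V\<close> are irrelevant.
\<close>

definition placement :: "'v set set \<Rightarrow> ('v \<Rightarrow> 'x) \<Rightarrow> bool" where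
  "placement E p \<longleftrightarrow> (\<forall>v w. {v, w} \<in> E \<longrightarrow> p v \<noteq> p w)"

definition well_positioned :: "'v set set \<Rightarrow> ('v \<Rightarrow> 'x::real_normed_vector) \<Rightarrow> bool" where
  "well_positioned E p \<longleftrightarrow> (\<forall>v w. {v, w} \<in> E \<longrightarrow> smooth_point (p v - p w))"

definition basis_family :: "(nat \<Rightarrow> 'x::real_vector) \<Rightarrow> bool" where
  "basis_family b \<longleftrightarrow>
     inj_on b {1..dim (UNIV :: 'x set)} \<and>
     independent (b ` {1..dim (UNIV :: 'x set)}) \<and>
     span (b ` {1..dim (UNIV :: 'x set)}) = UNIV"

text \<open>
  If \<open>e = {v, w}\<close> with \<open>v \<noteq> w\<close>, then \<open>the_elem (e - {v})\<close> is the other end \<open>w\<close>, so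
  the \<open>(e, (v, k))\<close> entry is the value at \<open>b k\<close> of the support functional of \<open>p v - p w\<close>.
\<close>

definition rigidity_matrix ::
  "(nat \<Rightarrow> 'x::real_normed_vector) \<Rightarrow> ('v \<Rightarrow> 'x) \<Rightarrow> 'v set \<Rightarrow> 'v \<times> nat \<Rightarrow> real" where
  "rigidity_matrix b p e = (\<lambda>(v, k).
     if v \<in> e then support_functional (p v - p (the_elem (e - {v}))) (b k) else 0)"

definition framework_independent ::
  "(nat \<Rightarrow> 'x::real_normed_vector) \<Rightarrow> 'v set \<Rightarrow> 'v set set \<Rightarrow> ('v \<Rightarrow> 'x) \<Rightarrow> bool" where
  "framework_independent b V E p \<longleftrightarrow>
     (\<forall>a :: 'v set \<Rightarrow> real.
        (\<forall>j \<in> V \<times> {1..dim (UNIV :: 'x set)}. (\<Sum>e\<in>E. a e * rigidity_matrix b p e j) = 0)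
        \<longrightarrow> (\<forall>e\<in>E. a e = 0))"

definition graph_independent ::
  "(nat \<Rightarrow> 'x::real_normed_vector) \<Rightarrow> 'v set \<Rightarrow> 'v set set \<Rightarrow> bool" where
  "graph_independent b V E \<longleftrightarrow>
     (\<exists>p. placement E p \<and> well_positioned E p \<and> framework_independent b V E p)"


section \<open>Triangulations of the sphere\<close>

text \<open>
  The bijection \<open>h\<close> identifies the vertex set of the graph with the set of vertices of the geometric
  complex \<open>C\<close>. Graphs with vertices in an arbitrary type are thereby covered, not only those whose
  vertices are points of a Euclidean space.
\<close>

definition one_skeleton :: "'e::euclidean_space set set \<Rightarrow> 'v set \<Rightarrow> 'v set set \<Rightarrow> bool" where
  "one_skeleton C V E \<longleftrightarrow>
     (\<exists>h. bij_betw h V {x. {x} \<in> C} \<and>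
          E = {{v, w} | v w. v \<in> V \<and> w \<in> V \<and> v \<noteq> w \<and> closed_segment (h v) (h w) \<in> C})"

definition sphere_triangulation :: "'e::euclidean_space set set \<Rightarrow> 'v set \<Rightarrow> 'v set set \<Rightarrow> bool" where
  "sphere_triangulation C V E \<longleftrightarrow>
     simplicial_complex C \<and> \<Union>C homeomorphic sphere (0 :: real^3) 1 \<and> one_skeleton C V E"

end

(*
  A finite graph is called planar here if it carries a finite family of "faces" (even edge sets), every
  edge lying on none or two of them, such that every set of edges meeting all faces evenly is a
  cut. This is MacLane's criterion read in the dual; it survives deletions and contractions, and
  comparing the number of sets of edges orthogonal to the faces with the number of cuts yields
  |E| <= 3|V| - 6. Applying this bound to the graph and to a closed neighbourhood of a vertex of degree
  at most 5 produces an edge uv with at most two common neighbours.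

  For a triangulated sphere the triangles (and one extra face) are such a family: a third triangle on an
  edge would contradict invariance of domain, and a mod 2 cocycle is a coboundary because the
  sphere is simply connected.

  Independence follows by contracting uv and splitting the vertex again. Put v at u + d/n. In the limit
  the row of uv becomes the support functional of d, and the rows are independent iff
  the functionals of d, u - w and u - w' (w, w' the common neighbours) are. By strict convexity the last
  two are independent in general position, and any d in their common kernel completes them.
  Smoothness makes the support functional continuous, so independence persists for large n.
*)
theory Submission
  imports Defs
begin

section \<open>The duality map\<close>

text \<open>The induction runs over combinatorially planar graphs, not over triangulations: a
  contracted graph does not come with a geometric complex, and the edge bound is also applied to the
  closed neighbourhood of a vertex, which is not a sphere. The vector d completes the two
  functionals because its own functional takes the value (norm d)^2 at d, where the other two
  vanish; in dimension 3 two functionals always have a common zero of this kind. Strict convexity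
  excludes flat faces of the unit ball, on which non-parallel directions have proportional
  functionals. The row of the short edge uv tends to zero like 1/n. It is multiplied by n before the
  limit is taken, which changes no independence. Simple connectivity speaks of paths, a cocycle of
  edges. The bridge is a sign attached to pairs of nearby points of the sphere: each point is sent
  to a nearby vertex, and the signs are multiplied along paths.\<close>

lemma bounded_family_convergent_subseq:
  fixes f :: "nat \<Rightarrow> 'i \<Rightarrow> real"
  assumes "finite A" "\<And>n x. x \<in> A \<Longrightarrow> \<bar>f n x\<bar> \<le> B x"
  obtains r l where "strict_mono (r :: nat \<Rightarrow> nat)" "\<And>x. x \<in> A \<Longrightarrow> (\<lambda>n. f (r n) x) \<longlonglongrightarrow> l x"
proof -
  have "\<exists>r l. strict_mono (r :: nat \<Rightarrow> nat) \<and> (\<forall>x\<in>A. (\<lambda>n. f (r n) x) \<longlonglongrightarrow> l x)"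
    using assms
  proof (induction A rule: finite_induct)
    case empty
    show ?case by (intro exI[of _ id]) (auto simp: strict_mono_def)
  next
    case (insert x A)
    then obtain r l where r: "strict_mono r" "\<forall>x\<in>A. (\<lambda>n. f (r n) x) \<longlonglongrightarrow> l x"
      by auto
    have "bounded (range (\<lambda>n. f (r n) x))"
      using insert.prems[of x] by (auto simp: bounded_iff)
    then obtain y s where s: "strict_mono (s :: nat \<Rightarrow> nat)" "((\<lambda>n. f (r n) x) \<circ> s) \<longlonglongrightarrow> y"
      using bounded_imp_convergent_subsequence by blast
    show ?case
    proof (intro exI conjI ballI)
      show "strict_mono (r \<circ> s)" using r s by (simp add: strict_mono_o)
      fix z assume "z \<in> insert x A"
      then show "(\<lambda>n. f ((r \<circ> s) n) z) \<longlonglongrightarrow> (l(x := y)) z"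
        using s r insert.hyps LIMSEQ_subseq_LIMSEQ[OF _ s(1), of "\<lambda>n. f (r n) z" "l z"]
        by (auto simp: o_def)
    qed
  qed
  then show ?thesis using that by blast
qed

lemma not_eventually_sequentiallyE:
  assumes "\<not> (\<forall>\<^sub>F n in sequentially. P n)"
  obtains s where "filterlim s sequentially sequentially" "\<And>n. \<not> P (s n)"
proof -
  have "\<forall>N. \<exists>n\<ge>N. \<not> P n" using assms by (auto simp: eventually_sequentially)
  then obtain s where s: "\<And>N. s N \<ge> N" "\<And>N. \<not> P (s N)" by metis
  then have "filterlim s sequentially sequentially"
    using filterlim_at_top_mono[OF filterlim_ident, of s] by auto
  then show ?thesis using s that by blast
qed

definition rows_independent :: "'e set \<Rightarrow> 'j set \<Rightarrow> ('e \<Rightarrow> 'j \<Rightarrow> real) \<Rightarrow> bool" where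
  "rows_independent E J r \<longleftrightarrow>
     (\<forall>a. (\<forall>j\<in>J. (\<Sum>e\<in>E. a e * r e j) = 0) \<longrightarrow> (\<forall>e\<in>E. a e = 0))"

text \<open>Independence is an open condition: if it failed for arbitrarily large n, relations
  normalised to absolute coefficient sum 1 would accumulate at a nonzero relation among the limit
  rows.\<close>

lemma rows_independent_eventually:
  assumes "finite E"
    and lim: "\<And>e j. e \<in> E \<Longrightarrow> j \<in> J \<Longrightarrow> (\<lambda>n. R n e j) \<longlonglongrightarrow> r e j"
    and ind: "rows_independent E J r"
  shows "\<forall>\<^sub>F n in sequentially. rows_independent E J (R n)"
proof (rule ccontr)
  assume "\<not> ?thesis"
  then obtain s where s: "filterlim s sequentially sequentially"
    and nind: "\<And>n. \<not> rows_independent E J (R (s n))"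
    by (rule not_eventually_sequentiallyE) blast
  have "\<exists>a. (\<forall>j\<in>J. (\<Sum>e\<in>E. a e * R (s n) e j) = 0) \<and> (\<Sum>e\<in>E. \<bar>a e\<bar>) = 1" for n
  proof -
    obtain a where a: "\<forall>j\<in>J. (\<Sum>e\<in>E. a e * R (s n) e j) = 0" "\<exists>e\<in>E. a e \<noteq> 0"
      using nind[of n] by (auto simp: rows_independent_def)
    define t where "t = (\<Sum>e\<in>E. \<bar>a e\<bar>)"
    have "t > 0"
      using a(2) assms(1) unfolding t_def by (metis abs_ge_zero sum_pos2 zero_less_abs_iff)
    show ?thesis
    proof (intro exI conjI ballI)
      fix j assume "j \<in> J"
      have "(\<Sum>e\<in>E. a e / t * R (s n) e j) = (\<Sum>e\<in>E. a e * R (s n) e j) / t"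
        by (simp add: sum_divide_distrib)
      then show "(\<Sum>e\<in>E. a e / t * R (s n) e j) = 0" using a \<open>j \<in> J\<close> by simp
    next
      show "(\<Sum>e\<in>E. \<bar>a e / t\<bar>) = 1"
        using \<open>t > 0\<close> by (simp add: sum_divide_distrib[symmetric]) (simp add: t_def[symmetric])
    qed
  qed
  then obtain a where a: "\<And>n j. j \<in> J \<Longrightarrow> (\<Sum>e\<in>E. a n e * R (s n) e j) = 0"
    and a1: "\<And>n. (\<Sum>e\<in>E. \<bar>a n e\<bar>) = (1::real)"
    by metis
  have "\<bar>a n e\<bar> \<le> 1" if "e \<in> E" for n e
    using member_le_sum[OF that, of "\<lambda>e. \<bar>a n e\<bar>"] assms(1) a1[of n] by auto
  then obtain q l where q: "strict_mono (q :: nat \<Rightarrow> nat)"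
    and l: "\<And>e. e \<in> E \<Longrightarrow> (\<lambda>n. a (q n) e) \<longlonglongrightarrow> l e"
    using bounded_family_convergent_subseq[OF assms(1), of a "\<lambda>_. 1"] by blast
  have sq: "filterlim (\<lambda>n. s (q n)) sequentially sequentially"
    using s q filterlim_compose filterlim_subseq by blast
  have "(\<Sum>e\<in>E. l e * r e j) = 0" if "j \<in> J" for j
  proof -
    have "(\<lambda>n. \<Sum>e\<in>E. a (q n) e * R (s (q n)) e j) \<longlonglongrightarrow> (\<Sum>e\<in>E. l e * r e j)"
      using lim that sq l by (intro tendsto_sum tendsto_mult) (auto intro: filterlim_compose[OF lim sq])
    then show ?thesis using a[OF that] by (simp add: LIMSEQ_const_iff)
  qed
  then have "\<forall>e\<in>E. l e = 0" using ind by (auto simp: rows_independent_def)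
  moreover have "(\<lambda>n. \<Sum>e\<in>E. \<bar>a (q n) e\<bar>) \<longlonglongrightarrow> (\<Sum>e\<in>E. \<bar>l e\<bar>)"
    using l by (intro tendsto_sum tendsto_rabs) auto
  then have "(\<Sum>e\<in>E. \<bar>l e\<bar>) = 1" using a1 by (simp add: LIMSEQ_const_iff)
  ultimately show False by simp
qed

text \<open>With \<open>supportsI\<close> this trades the supremum in \<open>supports\<close> for a
  pointwise inequality, which survives scaling and limits. Boundedness of \<open>f\<close> makes the
  supremum a genuine upper bound.\<close>

lemma supports_bound:
  assumes "supports f x"
  shows "\<bar>f y\<bar> \<le> norm x * norm y"
proof (cases "y = 0")
  case True
  then show ?thesis using assms by (auto simp: supports_def linear_0 bounded_linear.linear)
next
  case False
  have bl: "bounded_linear f" using assms by (simp add: supports_def)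
  then obtain K where K: "\<And>z. norm (f z) \<le> norm z * K" "K \<ge> 0"
    using bounded_linear.nonneg_bounded by blast
  have "bdd_above ((\<lambda>x. \<bar>f x\<bar>) ` cball 0 1)"
  proof (rule bdd_aboveI2)
    fix z :: 'a assume "z \<in> cball 0 1"
    then show "\<bar>f z\<bar> \<le> K"
      using K(1)[of z] mult_right_mono[of "norm z" 1 K] K(2) by auto
  qed
  moreover have "y /\<^sub>R norm y \<in> cball 0 1" using False by simp
  ultimately have "\<bar>f (y /\<^sub>R norm y)\<bar> \<le> (SUP x\<in>cball 0 1. \<bar>f x\<bar>)"
    by (metis (mono_tags, lifting) cSUP_upper)
  then have "\<bar>f (y /\<^sub>R norm y)\<bar> \<le> norm x" using assms by (simp add: supports_def)
  then show ?thesis using False bl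
    by (simp add: linear_scale bounded_linear.linear abs_mult divide_simps)
qed

lemma supportsI:
  assumes "x \<noteq> 0" "bounded_linear f" "f x = (norm x)\<^sup>2" "\<And>y. \<bar>f y\<bar> \<le> norm x * norm y"
  shows "supports f x"
proof -
  have "(SUP y\<in>cball 0 1. \<bar>f y\<bar>) = norm x"
  proof (rule cSup_eq_maximum)
    have "\<bar>f (x /\<^sub>R norm x)\<bar> = norm x"
      using assms by (simp add: linear_scale bounded_linear.linear abs_mult power2_eq_square)
    moreover have "x /\<^sub>R norm x \<in> cball 0 1" using assms by simp
    ultimately show "norm x \<in> (\<lambda>y. \<bar>f y\<bar>) ` cball 0 1" by (metis imageI)
  next
    fix z assume "z \<in> (\<lambda>y. \<bar>f y\<bar>) ` cball 0 1"
    then obtain y where "norm y \<le> 1" "z = \<bar>f y\<bar>" by auto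
    then show "z \<le> norm x"
      using assms(4)[of y] mult_left_mono[of "norm y" 1 "norm x"] by simp
  qed
  then show ?thesis using assms by (simp add: supports_def)
qed

context
  assumes smooth: "smooth_space TYPE('x::real_normed_vector)"
begin

lemma supports_support_functional:
  assumes "x \<noteq> 0"
  shows "supports (support_functional x) (x::'x)"
proof -
  have "\<exists>!f. supports f x"
    using smooth assms by (simp add: smooth_space_def smooth_point_def)
  then show ?thesis unfolding support_functional_def by (rule theI')
qed

lemma support_functional_unique:
  assumes "x \<noteq> 0" "supports f (x::'x)"
  shows "support_functional x = f"
proof -
  have "\<exists>!f. supports f x"
    using smooth assms by (simp add: smooth_space_def smooth_point_def)
  then show ?thesis using assms supports_support_functional by blast
qed

lemma bounded_linear_support_functional: "x \<noteq> 0 \<Longrightarrow> bounded_linear (support_functional (x::'x))"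
  using supports_support_functional by (simp add: supports_def)

lemma linear_support_functional: "x \<noteq> 0 \<Longrightarrow> linear (support_functional (x::'x))"
  by (simp add: bounded_linear_support_functional bounded_linear.linear)

lemma support_functional_self: "x \<noteq> 0 \<Longrightarrow> support_functional x (x::'x) = (norm x)\<^sup>2"
  using supports_support_functional by (simp add: supports_def)

lemma support_functional_bound: "x \<noteq> 0 \<Longrightarrow> \<bar>support_functional x y\<bar> \<le> norm x * norm (y::'x)"
  using supports_support_functional supports_bound by blast

text \<open>The scaled functional passes the test of \<open>supportsI\<close>, and uniqueness does
  the rest. Negative \<open>c\<close> is included because the short edge of a vertex split is read
  in both orientations.\<close>

lemma support_functional_scaleR:
  assumes "x \<noteq> 0" "c \<noteq> 0"
  shows "support_functional (c *\<^sub>R x) y = c * support_functional (x::'x) y"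
proof -
  have "support_functional (c *\<^sub>R x) = (\<lambda>y. c * support_functional x y)"
  proof (rule support_functional_unique, use assms in simp, rule supportsI)
    show "bounded_linear (\<lambda>y. c * support_functional x y)"
      by (intro bounded_linear_const_mult bounded_linear_support_functional assms)
    show "c * support_functional x (c *\<^sub>R x) = (norm (c *\<^sub>R x))\<^sup>2"
      using assms by (simp add: linear_scale[OF linear_support_functional] support_functional_self
          power_mult_distrib power2_eq_square)
    show "\<bar>c * support_functional x y\<bar> \<le> norm (c *\<^sub>R x) * norm y" for y
      using support_functional_bound[OF assms(1), of y] mult_left_mono[of _ _ "\<bar>c\<bar>"]
      by (simp add: abs_mult mult.assoc)
  qed (use assms in simp)
  then show ?thesis by simp
qed

text \<open>Up to a sign of \<open>y\<close>, one functional is then extremal in both directions and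
  hence also on their sum. This turns the triangle inequality into an equality, which strict
  convexity permits only for parallel vectors.\<close>

lemma support_functional_proportional:
  assumes sc: "strictly_convex_space TYPE('x)"
    and "x \<noteq> 0" "y \<noteq> 0" and eq: "\<And>z. support_functional (x::'x) z = c * support_functional y z"
  shows "\<exists>d. x = d *\<^sub>R y"
proof (rule ccontr)
  assume nd: "\<nexists>d. x = d *\<^sub>R y"
  have "support_functional x x = c * support_functional y x" by (rule eq)
  also have "\<dots> \<le> \<bar>c\<bar> * \<bar>support_functional y x\<bar>" by (metis abs_ge_self abs_mult)
  also have "\<dots> \<le> \<bar>c\<bar> * (norm y * norm x)"
    using support_functional_bound assms by (intro mult_left_mono) auto
  finally have "norm x * norm x \<le> norm x * (\<bar>c\<bar> * norm y)"
    using support_functional_self[OF assms(2)] by (simp add: power2_eq_square algebra_simps)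
  then have 1: "norm x \<le> \<bar>c\<bar> * norm y" using assms(2) by simp
  \<comment> \<open>The sign of \<open>c\<close> is moved into \<open>y'\<close>, so that the
    functional of \<open>x\<close> takes the nonnegative value
    \<open>\<bar>c\<bar> * (norm y)\<^sup>2\<close> there.\<close>
  define y' where "y' = sgn c *\<^sub>R y"
  have "c \<noteq> 0" using 1 assms by auto
  then have y': "y' \<noteq> 0" "norm y' = norm y" using assms by (auto simp: y'_def abs_sgn_eq sgn_eq_0_iff)
  have "\<nexists>d. x = d *\<^sub>R y'" using nd by (auto simp: y'_def)
  then have "norm (x + y') < norm x + norm y'"
    using sc[unfolded strictly_convex_space_def, rule_format, of x y'] assms(2) y'(1) by simp
  then have 2: "norm x * norm (x + y') < norm x * (norm x + norm y)"
    using y' assms by simp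
  have "support_functional x y' = c * (sgn c * (norm y)\<^sup>2)"
    using linear_scale[OF linear_support_functional[OF assms(3)]] support_functional_self[OF assms(3)]
    unfolding eq y'_def by simp
  then have "support_functional x y' = \<bar>c\<bar> * (norm y)\<^sup>2"
    by (simp add: abs_sgn[of c] mult.assoc)
  then have "support_functional x (x + y') = (norm x)\<^sup>2 + \<bar>c\<bar> * (norm y)\<^sup>2"
    using linear_add[OF linear_support_functional[OF assms(2)]] support_functional_self[OF assms(2)]
    by simp
  moreover have "norm x * norm y \<le> \<bar>c\<bar> * (norm y)\<^sup>2"
    using mult_right_mono[OF 1, of "norm y"] by (simp add: power2_eq_square mult.assoc)
  ultimately show False
    using 2 support_functional_bound[OF assms(2), of "x + y'"]
    by (simp add: power2_eq_square algebra_simps)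
qed

text \<open>A cluster point of the functionals of \<open>X n\<close> inherits linearity, the norm
  bound and the right value at \<open>x\<close>, so it supports \<open>x\<close>; smoothness leaves
  one candidate only. Finite dimension enters through the subsequence, which is extracted on a basis
  and extended by linearity.\<close>

lemma tendsto_support_functional:
  fixes b :: "nat \<Rightarrow> 'x" and X :: "nat \<Rightarrow> 'x"
  assumes b: "basis_family b" and lim: "X \<longlonglongrightarrow> x" and "x \<noteq> 0"
  shows "(\<lambda>n. support_functional (X n) y) \<longlonglongrightarrow> support_functional x y"
proof (rule tendstoI, rule ccontr)
  fix e :: real assume "e > 0"
  assume "\<not> (\<forall>\<^sub>F n in sequentially. dist (support_functional (X n) y) (support_functional x y) < e)"
  moreover have "\<forall>\<^sub>F n in sequentially. X n \<noteq> 0"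
    using lim \<open>x \<noteq> 0\<close> by (rule tendsto_imp_eventually_ne)
  \<comment> \<open>Zero terms are counted as good, so every term of the bad subsequence is nonzero
    and has a genuine support functional.\<close>
  ultimately have "\<not> (\<forall>\<^sub>F n in sequentially.
      X n = 0 \<or> dist (support_functional (X n) y) (support_functional x y) < e)"
    using eventually_elim2 by (smt (verit, ccfv_threshold))
  then obtain s where s: "filterlim s sequentially sequentially"
    and s0: "\<And>n. X (s n) \<noteq> 0"
    and far: "\<And>n. dist (support_functional (X (s n)) y) (support_functional x y) \<ge> e"
    by (rule not_eventually_sequentiallyE) (auto simp: not_less)
  define D where "D = b ` {1..dim (UNIV::'x set)}"
  have D: "finite D" "span D = UNIV" using b by (auto simp: D_def basis_family_def)
  have Xs: "(\<lambda>n. X (s n)) \<longlonglongrightarrow> x" using filterlim_compose[OF lim s] .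
  then obtain B where B: "\<And>n. norm (X (s n)) \<le> B"
    using Bseq_def[of "\<lambda>n. X (s n)"] convergent_imp_Bseq convergentI by metis
  have "\<bar>support_functional (X (s n)) z\<bar> \<le> B * norm z" for n z
    using order.trans[OF support_functional_bound[OF s0] mult_right_mono[OF B norm_ge_zero]] .
  then obtain r l where r: "strict_mono (r :: nat \<Rightarrow> nat)"
    and l: "\<And>z. z \<in> D \<Longrightarrow> (\<lambda>n. support_functional (X (s (r n))) z) \<longlonglongrightarrow> l z"
    using bounded_family_convergent_subseq[OF D(1),
        of "\<lambda>n. support_functional (X (s n))" "\<lambda>z. B * norm z"] by blast
  define Y where "Y n = X (s (r n))" for n
  have Y: "Y \<longlonglongrightarrow> x" "\<And>n. Y n \<noteq> 0"
    using LIMSEQ_subseq_LIMSEQ[OF Xs r] s0 by (auto simp: Y_def[abs_def] o_def)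
  have "convergent (\<lambda>n. support_functional (Y n) z)" for z
  proof -
    have "z \<in> span D" using D by simp
    then show ?thesis
    proof (induction rule: span_induct_alt)
      case base
      then show ?case using linear_0[OF linear_support_functional[OF Y(2)]]
        by (simp add: convergent_const)
    next
      case (step c u v)
      have "convergent (\<lambda>n. support_functional (Y n) u)"
        using l[OF step(1)] by (auto simp: convergent_def Y_def)
      then show ?case using step linear_support_functional[OF Y(2)]
        by (simp add: linear_add linear_scale convergent_add convergent_mult convergent_const)
    qed
  qed
  then obtain \<psi> where \<psi>: "\<And>z. (\<lambda>n. support_functional (Y n) z) \<longlonglongrightarrow> \<psi> z"
    unfolding convergent_def by metis
  have bound: "\<bar>\<psi> z\<bar> \<le> norm x * norm z" for z
  proof (rule LIMSEQ_le)
    show "(\<lambda>n. \<bar>support_functional (Y n) z\<bar>) \<longlonglongrightarrow> \<bar>\<psi> z\<bar>" by (intro tendsto_rabs \<psi>)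
    show "(\<lambda>n. norm (Y n) * norm z) \<longlonglongrightarrow> norm x * norm z" by (intro tendsto_intros Y)
    show "\<exists>N. \<forall>n\<ge>N. \<bar>support_functional (Y n) z\<bar> \<le> norm (Y n) * norm z"
      using support_functional_bound Y by auto
  qed
  have "bounded_linear \<psi>"
  proof (rule bounded_linear_intro)
    fix u v :: 'x and c :: real
    have "(\<lambda>n. support_functional (Y n) u + support_functional (Y n) v) \<longlonglongrightarrow> \<psi> u + \<psi> v"
      by (intro tendsto_intros \<psi>)
    moreover have "(\<lambda>n. support_functional (Y n) (u + v)) \<longlonglongrightarrow> \<psi> (u + v)" by (rule \<psi>)
    ultimately show "\<psi> (u + v) = \<psi> u + \<psi> v"
      by (simp add: linear_add[OF linear_support_functional[OF Y(2)]] LIMSEQ_unique)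
    have "(\<lambda>n. c * support_functional (Y n) u) \<longlonglongrightarrow> c * \<psi> u"
      by (intro tendsto_intros \<psi>)
    moreover have "(\<lambda>n. support_functional (Y n) (c *\<^sub>R u)) \<longlonglongrightarrow> \<psi> (c *\<^sub>R u)" by (rule \<psi>)
    ultimately show "\<psi> (c *\<^sub>R u) = c *\<^sub>R \<psi> u"
      by (simp add: linear_scale[OF linear_support_functional[OF Y(2)]] LIMSEQ_unique)
    show "norm (\<psi> u) \<le> norm u * norm x" using bound[of u] by (simp add: mult.commute)
  qed
  \<comment> \<open>The value at the moving point \<open>Y n\<close> is known exactly; the error
    from replacing \<open>x\<close> by \<open>Y n\<close> is at most
    \<open>norm (Y n) * norm (x - Y n)\<close>.\<close>
  moreover have "\<psi> x = (norm x)\<^sup>2"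
  proof -
    have "(\<lambda>n. norm (Y n) * norm (x - Y n)) \<longlonglongrightarrow> norm x * norm (x - x)"
      by (intro tendsto_intros Y)
    then have "(\<lambda>n. norm (Y n) * norm (x - Y n)) \<longlonglongrightarrow> 0" by simp
    then have "(\<lambda>n. support_functional (Y n) (x - Y n)) \<longlonglongrightarrow> 0"
      by (rule Lim_null_comparison[rotated]) (use support_functional_bound Y in auto)
    moreover have "(\<lambda>n. (norm (Y n))\<^sup>2) \<longlonglongrightarrow> (norm x)\<^sup>2" by (intro tendsto_intros Y)
    ultimately have "(\<lambda>n. (norm (Y n))\<^sup>2 + support_functional (Y n) (x - Y n)) \<longlonglongrightarrow> (norm x)\<^sup>2 + 0"
      by (intro tendsto_add)
    then show ?thesis using \<psi>[of x] linear_support_functional[OF Y(2)]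
      by (simp add: linear_diff support_functional_self[OF Y(2)] LIMSEQ_unique)
  qed
  ultimately have "support_functional x = \<psi>"
    using \<open>x \<noteq> 0\<close> bound by (intro support_functional_unique supportsI)
  then have "(\<lambda>n. dist (support_functional (Y n) y) (support_functional x y)) \<longlonglongrightarrow> 0"
    using tendsto_dist_iff[THEN iffD1, OF \<psi>[of y]] by simp
  moreover have "\<exists>N. \<forall>n\<ge>N. e \<le> dist (support_functional (Y n) y) (support_functional x y)"
    using far by (auto simp: Y_def)
  ultimately have "e \<le> 0" by (rule LIMSEQ_le_const)
  then show False using \<open>e > 0\<close> by simp
qed

end

section \<open>Graphs and edge contraction\<close>

definition simple_edges :: "'v set set \<Rightarrow> bool" where
  "simple_edges E \<longleftrightarrow> finite E \<and> (\<forall>e\<in>E. card e = 2)"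

definition common_neighbours :: "'v set set \<Rightarrow> 'v \<Rightarrow> 'v \<Rightarrow> 'v set" where
  "common_neighbours E u v = {w. {u, w} \<in> E \<and> {v, w} \<in> E}"

definition merge_vertex :: "'v \<Rightarrow> 'v \<Rightarrow> 'v \<Rightarrow> 'v" where
  "merge_vertex u v x = (if x = v then u else x)"

text \<open>Being a set of sets, it fuses the parallel edges \<open>{u, w}\<close> and
  \<open>{v, w}\<close> of a common neighbour \<open>w\<close>. For u different from v, the vertex
  \<open>v\<close> remains in the type but lies on no edge.\<close>

definition contract :: "'v \<Rightarrow> 'v \<Rightarrow> 'v set set \<Rightarrow> 'v set set" where
  "contract u v E = image (merge_vertex u v) ` (E - {{u, v}})"

lemma simple_edgesE:
  assumes "simple_edges E" "e \<in> E"
  obtains x y where "e = {x, y}" "x \<noteq> y"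
proof -
  have "card e = 2" using assms by (simp add: simple_edges_def)
  then obtain x y where "e = {x, y}" "x \<noteq> y" unfolding card_2_iff by blast
  then show ?thesis by (rule that)
qed

lemma simple_edges_distinct: "simple_edges E \<Longrightarrow> {x, y} \<in> E \<Longrightarrow> x \<noteq> y"
  unfolding simple_edges_def by (metis card_1_singleton_iff insert_absorb2 n_not_Suc_n numeral_2_eq_2 One_nat_def)

lemma simple_edges_subset: "simple_edges E \<Longrightarrow> E' \<subseteq> E \<Longrightarrow> simple_edges E'"
  unfolding simple_edges_def by (meson finite_subset subsetD)

lemma merge_vertex_distinct:
  assumes "{x, y} \<noteq> {u, v}" "x \<noteq> y"
  shows "merge_vertex u v x \<noteq> merge_vertex u v y"
  using assms by (auto simp: merge_vertex_def)

lemma simple_edges_contract: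
  assumes "simple_edges E"
  shows "simple_edges (contract u v E)"
  unfolding simple_edges_def
proof (intro conjI ballI)
  show "finite (contract u v E)" using assms by (simp add: contract_def simple_edges_def)
  fix e assume "e \<in> contract u v E"
  then obtain f where f: "f \<in> E" "f \<noteq> {u, v}" "e = merge_vertex u v ` f" by (auto simp: contract_def)
  with assms obtain x y where "f = {x, y}" "x \<noteq> y" by (metis simple_edgesE)
  with f merge_vertex_distinct[of x y u v] show "card e = 2" by simp
qed

text \<open>Only edges at \<open>v\<close> are moved, and moved edges stay distinct from each other,
  as do unmoved ones. A coincidence therefore pairs a moved edge \<open>{v, w}\<close> with the
  unmoved \<open>{u, w}\<close>.\<close>

lemma merge_vertex_image_eqD:
  assumes E: "simple_edges E" and e: "e \<in> E" "e' \<in> E" "e \<noteq> {u, v}" "e' \<noteq> {u, v}"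
    and eq: "merge_vertex u v ` e = merge_vertex u v ` e'" "e \<noteq> e'"
  shows "\<exists>w\<in>common_neighbours E u v. e = {u, w} \<and> e' = {v, w} \<or> e = {v, w} \<and> e' = {u, w}"
proof -
  have fixed: "merge_vertex u v ` f = f" if "v \<notin> f" for f
    using that by (force simp: merge_vertex_def)
  have moved: "\<exists>w. f = {v, w} \<and> w \<noteq> u \<and> merge_vertex u v ` f = {u, w}"
    if f: "v \<in> f" "f \<in> E" "f \<noteq> {u, v}" for f
  proof -
    obtain x y where xy: "f = {x, y}" "x \<noteq> y" by (rule simple_edgesE[OF E f(2)])
    define w where "w = (if v = x then y else x)"
    have "v = x \<or> v = y" using that(1) xy(1) by simp
    then have w: "f = {v, w}" "w \<noteq> v" unfolding w_def xy(1) using xy(2) by (elim disjE; simp add: insert_commute)+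
    have wu: "w \<noteq> u" using f(3) unfolding w(1) by (auto simp: insert_commute)
    have "merge_vertex u v ` f = {u, w}" unfolding w(1) using w(2) by (auto simp: merge_vertex_def)
    with w(1) wu show ?thesis by (intro exI[of _ w] conjI)
  qed
  have moved': "\<exists>w\<in>common_neighbours E u v. f = {v, w} \<and> f' = {u, w}"
    if f: "v \<in> f" "v \<notin> f'" "f \<in> E" "f' \<in> E" "f \<noteq> {u, v}" "merge_vertex u v ` f = merge_vertex u v ` f'" for f f'
  proof -
    obtain w where w: "f = {v, w}" "merge_vertex u v ` f = {u, w}" using moved[OF f(1,3,5)] by blast
    then have f': "f' = {u, w}" using fixed[OF f(2)] f(6) by simp
    then have "w \<in> common_neighbours E u v" using w(1) f(3,4) by (simp add: common_neighbours_def)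
    with w(1) f' show ?thesis by (intro bexI[of _ w] conjI)
  qed
  have "\<not> (v \<in> e \<and> v \<in> e')"
    
  proof
    assume "v \<in> e \<and> v \<in> e'"
    then obtain w w' where w: "e = {v, w}" "merge_vertex u v ` e = {u, w}" "w \<noteq> u"
        "e' = {v, w'}" "merge_vertex u v ` e' = {u, w'}"
      using moved[OF _ e(1,3)] moved[OF _ e(2,4)] by blast
    have "{u, w} = {u, w'}" using w(2,5) eq(1) by (metis (no_types))
    then have "w = w'" by (auto simp: doubleton_eq_iff)
    then show False using w(1,4) eq(2) by (metis (no_types))
  qed
  moreover have "v \<in> e \<or> v \<in> e'"
  proof (rule ccontr)
    assume "\<not> ?thesis"
    then have "merge_vertex u v ` e = e" "merge_vertex u v ` e' = e'" using fixed by blast+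
    then show False using eq by (metis (no_types))
  qed
  ultimately consider "v \<in> e" "v \<notin> e'" | "v \<in> e'" "v \<notin> e" by blast
  then show ?thesis
  proof cases
    case 1
    from moved'[OF 1 e(1,2,3) eq(1)] show ?thesis by (elim bexE) (intro bexI disjI2)
  next
    case 2
    from moved'[OF 2 e(2,1,4) eq(1)[symmetric]] show ?thesis
      by (elim bexE conjE) (intro bexI disjI1 conjI)
  qed
qed

section \<open>Vertex splitting\<close>

lemma rigidity_matrix_edge:
  assumes "y \<noteq> z"
  shows "rigidity_matrix b p {y, z} (t, k) =
    (if t = y then support_functional (p y - p z) (b k)
     else if t = z then support_functional (p z - p y) (b k) else 0)"
proof -
  have "{y, z} - {y} = {z}" "{y, z} - {z} = {y}" using assms by auto
  then show ?thesis by (auto simp: rigidity_matrix_def)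
qed

text \<open>With trivial common kernel, the pair \<open>(f, g)\<close> would embed three independent
  vectors into a plane. The functionals may be equal or zero, which serves edges with fewer than two
  common neighbours.\<close>

lemma common_kernel_vector:
  fixes f g :: "'x::real_vector \<Rightarrow> real"
  assumes "dim (UNIV :: 'x set) = 3" "basis_family (b :: nat \<Rightarrow> 'x)" "linear f" "linear g"
  shows "\<exists>d. d \<noteq> 0 \<and> f d = 0 \<and> g d = 0"
proof (rule ccontr)
  assume no: "\<not> ?thesis"
  define D where "D = b ` {1..3}"
  have D: "independent D" "card D = 3"
    using assms by (auto simp: basis_family_def D_def card_image)
  have lin: "linear (\<lambda>x. (f x, g x))"
    using assms(3,4) by (auto simp: linear_iff)
  have inj: "inj (\<lambda>x. (f x, g x))"
    unfolding linear_injective_0[OF lin] using no by (auto simp: zero_prod_def)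
  have "independent ((\<lambda>x. (f x, g x)) ` D)"
    using linear_independent_injective_image[OF lin D(1)] inj by (meson inj_on_subset top_greatest)
  then have "card ((\<lambda>x. (f x, g x)) ` D) \<le> DIM(real \<times> real)" by (rule independent_card_le)
  moreover have "card ((\<lambda>x. (f x, g x)) ` D) = 3"
    using inj D(2) by (metis card_image inj_on_subset top_greatest)
  ultimately show False by simp
qed

text \<open>Columns range over the whole vertex type, so a graph and its contraction are compared
  without tracking vertex sets; columns of vertices on no edge are zero.\<close>

definition independent_placement :: "(nat \<Rightarrow> 'x::real_normed_vector) \<Rightarrow> 'v set set \<Rightarrow> ('v \<Rightarrow> 'x) \<Rightarrow> bool" where
  "independent_placement b E p \<longleftrightarrow> placement E p \<and>
     rows_independent E (UNIV \<times> {1..dim (UNIV :: 'x set)}) (rigidity_matrix b p)"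

context
  fixes b :: "nat \<Rightarrow> 'x::real_normed_vector"
  assumes smooth: "smooth_space TYPE('x)" and basis: "basis_family b"
begin

lemma linear_zero_on_basis:
  fixes f :: "'x \<Rightarrow> real"
  assumes "linear f" "\<And>k. k \<in> {1..dim (UNIV :: 'x set)} \<Longrightarrow> f (b k) = 0"
  shows "f y = 0"
proof -
  have "y \<in> span (b ` {1..dim (UNIV :: 'x set)})"
    using basis by (simp add: basis_family_def)
  then show ?thesis
    using linear_eq_0_on_span[OF assms(1), of "b ` {1..dim (UNIV :: 'x set)}" y] assms(2) by blast
qed

text \<open>Joins the openness of row independence to the continuity of the support functional; it
  is what allows a vertex to be moved slightly.\<close>

lemma eventually_independent_placement:
  assumes E: "simple_edges E" and p: "independent_placement b E p"
    and lim: "\<And>x. (\<lambda>n. q n x) \<longlonglongrightarrow> p x"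
  shows "\<forall>\<^sub>F n in sequentially. independent_placement b E (q n)"
proof -
  have ne: "p x - p y \<noteq> 0" if "{x, y} \<in> E" for x y
    using p that by (auto simp: independent_placement_def placement_def)
  have conv: "(\<lambda>n. q n x - q n y) \<longlonglongrightarrow> p x - p y" for x y
    by (intro tendsto_intros lim)
  have "\<forall>\<^sub>F n in sequentially. \<forall>e\<in>E. \<forall>x y. e = {x, y} \<longrightarrow> q n x \<noteq> q n y"
  proof (rule eventually_ball_finite)
    show "\<forall>e\<in>E. \<forall>\<^sub>F n in sequentially. \<forall>x y. e = {x, y} \<longrightarrow> q n x \<noteq> q n y"
    proof
      fix e assume "e \<in> E"
      then obtain x y where xy: "e = {x, y}" using E by (metis simple_edgesE)
      have "\<forall>\<^sub>F n in sequentially. q n x - q n y \<noteq> 0"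
        using conv[of x y] ne[of x y] xy \<open>e \<in> E\<close> by (intro tendsto_imp_eventually_ne) auto
      then show "\<forall>\<^sub>F n in sequentially. \<forall>x y. e = {x, y} \<longrightarrow> q n x \<noteq> q n y"
        by (rule eventually_mono) (auto simp: xy doubleton_eq_iff)
    qed
    show "finite E" using E by (simp add: simple_edges_def)
  qed
  then have "\<forall>\<^sub>F n in sequentially. placement E (q n)"
    by (rule eventually_mono) (auto simp: placement_def)
  moreover have "\<forall>\<^sub>F n in sequentially.
     rows_independent E (UNIV \<times> {1..dim (UNIV :: 'x set)}) (rigidity_matrix b (q n))"
  proof (rule rows_independent_eventually)
    show "finite E" using E by (simp add: simple_edges_def)
    show "rows_independent E (UNIV \<times> {1..dim (UNIV :: 'x set)}) (rigidity_matrix b p)"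
      using p by (simp add: independent_placement_def)
    fix e j assume "e \<in> E" "j \<in> (UNIV :: 'a set) \<times> {1..dim (UNIV :: 'x set)}"
    then obtain x y t k where xy: "e = {x, y}" "x \<noteq> y" "j = (t, k)" using E by (metis simple_edgesE surj_pair)
    then have xyE: "{x, y} \<in> E" "{y, x} \<in> E" using \<open>e \<in> E\<close> by (auto simp: insert_commute)
    show "(\<lambda>n. rigidity_matrix b (q n) e j) \<longlonglongrightarrow> rigidity_matrix b p e j"
      unfolding xy rigidity_matrix_edge[OF xy(2)]
      using tendsto_support_functional[OF smooth basis conv ne] xyE by auto
  qed
  ultimately show ?thesis unfolding independent_placement_def by eventually_elim simp
qed

text \<open>Two of these functionals are dependent only if the directions from \<open>u\<close> are
  parallel, by \<open>support_functional_proportional\<close>. A small move of one neighbour ends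
  this and keeps the placement independent.\<close>

lemma independent_placement_general_position:
  assumes sc: "strictly_convex_space TYPE('x)" and dim: "dim (UNIV :: 'x set) = 3"
    and E: "simple_edges E" and p: "independent_placement b E p"
    and W: "finite W" "card W \<le> 2" "\<And>w. w \<in> W \<Longrightarrow> {u, w} \<in> E"
  obtains q where "independent_placement b E q"
    "\<And>\<alpha>. \<lbrakk>\<And>y. (\<Sum>w\<in>W. \<alpha> w * support_functional (q u - q w) y) = 0\<rbrakk> \<Longrightarrow> \<forall>w\<in>W. \<alpha> w = 0"
proof -
  have ne: "q u - q w \<noteq> 0" if "independent_placement b E q" "w \<in> W" for q w
    using W(3)[OF that(2)] that(1) by (auto simp: independent_placement_def placement_def)
  consider "W = {}" | w where "W = {w}" | w1 w2 where "W = {w1, w2}" "w1 \<noteq> w2"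
  proof -
    have "card W = 0 \<or> card W = 1 \<or> card W = 2" using W(2) by auto
    then show ?thesis using that W(1) by (elim disjE) (auto simp: card_1_singleton_iff card_2_iff)
  qed
  then show ?thesis
  proof cases
    case 1
    then show ?thesis using that[OF p] by simp
  next
    case 2
    have "\<forall>w\<in>W. \<alpha> w = 0" if "\<And>y. (\<Sum>w\<in>W. \<alpha> w * support_functional (p u - p w) y) = 0" for \<alpha>
      using that[of "p u - p w"] ne[OF p] 2 by (simp add: support_functional_self[OF smooth])
    then show ?thesis using that[OF p] by blast
  next
    case 3
    obtain z where z: "z \<notin> span {p u - p w2}"
    proof -
      have "dim {p u - p w2} \<le> card {p u - p w2}"
        by (rule real_vector.dim_le_card') simp
      then have "dim (span {p u - p w2}) \<le> 1" by (simp add: real_vector.dim_span)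
      then have "span {p u - p w2} \<noteq> UNIV" using dim by (metis numeral_le_one_iff semiring_norm(70))
      then show ?thesis using that by blast
    qed
    have "\<exists>q. independent_placement b E q \<and> q u = p u \<and> q w2 = p w2 \<and> q u - q w1 \<notin> span {p u - p w2}"
    proof (cases "p u - p w1 \<in> span {p u - p w2}")
      case False
      then show ?thesis using p by blast
    next
      case True
      \<comment> \<open>Only \<open>w1\<close> moves, along a vector off the line of the other
        direction; \<open>u\<close> and \<open>w2\<close>, and with them that line, stay
        fixed.\<close>
      define q where "q n = p(w1 := p w1 - (1 / real (Suc n)) *\<^sub>R z)" for n
      have "(\<lambda>n. p w1 - (1 / real (Suc n)) *\<^sub>R z) \<longlonglongrightarrow> p w1 - 0 *\<^sub>R z"
        by (intro tendsto_intros lim_1_over_n LIMSEQ_Suc[OF lim_1_over_n])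
      then have "(\<lambda>n. q n x) \<longlonglongrightarrow> p x" for x by (cases "x = w1") (simp_all add: q_def)
      then have "\<forall>\<^sub>F n in sequentially. independent_placement b E (q n)"
        by (rule eventually_independent_placement[OF E p])
      then obtain n where n: "independent_placement b E (q n)"
        using eventually_happens' sequentially_bot by blast
      have "u \<noteq> w1" using W(3)[of w1] 3 simple_edges_distinct[OF E] by blast
      have "p u - p w1 + (1 / real (Suc n)) *\<^sub>R z \<notin> span {p u - p w2}"
      proof
        assume "p u - p w1 + (1 / real (Suc n)) *\<^sub>R z \<in> span {p u - p w2}"
        from span_diff[OF this True] have "(1 / real (Suc n)) *\<^sub>R z \<in> span {p u - p w2}" by simp
        then have "real (Suc n) *\<^sub>R (1 / real (Suc n)) *\<^sub>R z \<in> span {p u - p w2}" by (rule span_scale)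
        then show False using z by simp
      qed
      then have "q n u = p u \<and> q n w2 = p w2 \<and> q n u - q n w1 \<notin> span {p u - p w2}"
        using 3 \<open>u \<noteq> w1\<close> by (simp add: q_def algebra_simps)
      then show ?thesis using n by blast
    qed
    then obtain q where q: "independent_placement b E q" "q u = p u" "q w2 = p w2"
      "q u - q w1 \<notin> span {p u - p w2}" by blast
    have x: "q u - q w1 \<noteq> 0" "q u - q w2 \<noteq> 0" using ne[OF q(1)] 3 by auto
    have "\<forall>w\<in>W. \<alpha> w = 0" if "\<And>y. (\<Sum>w\<in>W. \<alpha> w * support_functional (q u - q w) y) = 0" for \<alpha>
    proof -
      have eq: "\<alpha> w1 * support_functional (q u - q w1) y + \<alpha> w2 * support_functional (q u - q w2) y = 0" for y
        using that[of y] 3 by simp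
      have "\<alpha> w1 = 0"
      proof (rule ccontr)
        assume "\<alpha> w1 \<noteq> 0"
        then have "support_functional (q u - q w1) y = - (\<alpha> w2 / \<alpha> w1) * support_functional (q u - q w2) y" for y
          using eq[of y] by (simp add: field_simps add_eq_0_iff)
        then obtain d where "q u - q w1 = d *\<^sub>R (q u - q w2)"
          using support_functional_proportional[OF smooth sc x] by blast
        then show False using q(2-4) by (simp add: span_scale span_base)
      qed
      moreover have "\<alpha> w2 = 0"
        using eq[of "q u - q w2"] calculation x by (simp add: support_functional_self[OF smooth])
      ultimately show ?thesis using 3 by simp
    qed
    then show ?thesis using that[OF q(1)] by blast
  qed
qed

end

context
  fixes b :: "nat \<Rightarrow> 'x::real_normed_vector"
  assumes smooth: "smooth_space TYPE('x)" and basis: "basis_family b"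
begin

text \<open>A relation among the rows of the limit matrix \<open>r\<close> first collapses to a
  relation of the contracted graph, where it is trivial. What survives is a relation at
  \<open>u\<close> between the functionals of \<open>d\<close> and of the directions to the common
  neighbours.\<close>

lemma vertex_split_independent:
  fixes p :: "'v \<Rightarrow> 'x"
  assumes E: "simple_edges E" and uv: "{u, v} \<in> E"
    and p: "independent_placement b (contract u v E) p"
    and W: "\<And>\<alpha>. \<lbrakk>\<And>y. (\<Sum>w\<in>common_neighbours E u v. \<alpha> w * support_functional (p u - p w) y) = 0\<rbrakk>
      \<Longrightarrow> \<forall>w\<in>common_neighbours E u v. \<alpha> w = 0"
    and d: "d \<noteq> 0" "\<And>w. w \<in> common_neighbours E u v \<Longrightarrow> support_functional (p u - p w) d = 0"
  shows "\<exists>q. independent_placement b E (q :: 'v \<Rightarrow> 'x)"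
proof -
  define K where "K = {1..dim (UNIV :: 'x set)}"
  define W where "W = common_neighbours E u v"
  define E0 where "E0 = E - {{u, v}}"
  define m where "m = merge_vertex u v"
  define q where "q n = p(v := p u + (1 / real (Suc n)) *\<^sub>R d)" for n
  (* the limit of the rows at q n, the row of {u, v} being rescaled by Suc n *)
  define r where "r e = (\<lambda>(x, k).
      if e = {u, v} then if x = u then - support_functional d (b k)
        else if x = v then support_functional d (b k) else 0
      else rigidity_matrix b (p \<circ> m) e (x, k))" for e
  have finE: "finite E" using E by (simp add: simple_edges_def)
  have "u \<noteq> v" using simple_edges_distinct[OF E uv] .
  have vu: "{v, u} = {u, v}" by auto
  have E0: "finite E0" "E = insert {u, v} E0" "{u, v} \<notin> E0"
    using finE uv by (auto simp: E0_def)
  have ne: "p (m x) - p (m y) \<noteq> 0" if "{x, y} \<in> E0" for x y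
  proof -
    have "m ` {x, y} \<in> contract u v E" using that unfolding contract_def E0_def m_def by blast
    then show ?thesis using p by (auto simp: independent_placement_def placement_def)
  qed
  have sum_E: "(\<Sum>e\<in>E. g e) = g {u, v} + (\<Sum>e\<in>E0. g e)" for g :: "'v set \<Rightarrow> real"
    using E0 by simp
  have sf_d: "support_functional d d > 0"
    using d(1) by (simp add: support_functional_self[OF smooth])

  \<comment> \<open>Adding the columns of \<open>v\<close> to those of \<open>u\<close> turns
    \<open>r\<close> into the matrix of the contracted graph: the row of \<open>{u, v}\<close>
    cancels, and the edges \<open>{u, w}\<close> and \<open>{v, w}\<close> receive the same
    row.\<close>
  have merged: "rigidity_matrix b p (m ` e) (x, k) =
      (if x = v then 0 else if x = u then r e (u, k) + r e (v, k) else r e (x, k))"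
    if e: "e \<in> E0" for e x k
  proof -
    have "e \<in> E" using e E0(2) by blast
    then obtain y z where yz: "e = {y, z}" "y \<noteq> z" by (rule simple_edgesE[OF E])
    then have "{y, z} \<noteq> {u, v}" using E0(3) e by auto
    have mne: "m y \<noteq> m z" unfolding m_def using \<open>{y, z} \<noteq> {u, v}\<close> yz(2) by (rule merge_vertex_distinct)
    have mim: "m ` e = {m y, m z}" by (simp add: yz)
    have r: "r e (t, k) = (if t = y then support_functional (p (m y) - p (m z)) (b k)
        else if t = z then support_functional (p (m z) - p (m y)) (b k) else 0)" for t
      using \<open>{y, z} \<noteq> {u, v}\<close> rigidity_matrix_edge[OF yz(2), of b "p \<circ> m"] by (simp add: r_def yz(1))
    show ?thesis
      unfolding mim rigidity_matrix_edge[OF mne] r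
      using \<open>{y, z} \<noteq> {u, v}\<close> vu yz(2) \<open>u \<noteq> v\<close>
      by (cases "y = v"; cases "z = v"; cases "y = u"; cases "z = u") (simp_all add: m_def merge_vertex_def)
  qed

  \<comment> \<open>Independence of the limit matrix\<close>
  have ind: "rows_independent E (UNIV \<times> K) r"
    unfolding rows_independent_def
  proof (intro allI impI)
    fix a :: "'v set \<Rightarrow> real"
    assume "\<forall>j\<in>UNIV \<times> K. (\<Sum>e\<in>E. a e * r e j) = 0"
    then have a: "a {u, v} * r {u, v} (x, k) + (\<Sum>e\<in>E0. a e * r e (x, k)) = 0" if "k \<in> K" for x k
      using that by (simp add: sum_E)
    \<comment> \<open>Coefficients of edges that become equal are added, which gives a relation
      among the rows of the contracted graph.\<close>
    define a' where "a' f = (\<Sum>e | e \<in> E0 \<and> image m e = f. a e)" for f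
    have contr: "contract u v E = image m ` E0" by (simp add: contract_def E0_def m_def)
    have a': "\<forall>f\<in>contract u v E. a' f = 0"
    proof -
      have "(\<Sum>f\<in>contract u v E. a' f * rigidity_matrix b p f j) = 0" if jK: "j \<in> UNIV \<times> K" for j
      proof -
        obtain x k where j: "j = (x, k)" "k \<in> K" using jK by auto
        have "(\<Sum>f\<in>contract u v E. a' f * rigidity_matrix b p f j) =
            (\<Sum>f\<in>image m ` E0. \<Sum>e | e \<in> E0 \<and> image m e = f. a e * rigidity_matrix b p (m ` e) j)"
          unfolding contr a'_def by (intro sum.cong) (auto simp: sum_distrib_right)
        also have "\<dots> = (\<Sum>e\<in>E0. a e * rigidity_matrix b p (m ` e) j)"
          by (rule sum.group) (use E0 in auto)
        also have "\<dots> = (\<Sum>e\<in>E0. a e * (if x = v then 0 else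
            if x = u then r e (u, k) + r e (v, k) else r e (x, k)))"
          by (rule sum.cong) (simp_all add: j merged)
        also have "\<dots> = 0"
        proof -
          consider "x = v" | "x = u" "x \<noteq> v" | "x \<noteq> u" "x \<noteq> v" by blast
          then show ?thesis
          proof cases
            case 2
            have "r {u, v} (u, k) + r {u, v} (v, k) = 0" using \<open>u \<noteq> v\<close> by (simp add: r_def)
            then have "a {u, v} * r {u, v} (u, k) + a {u, v} * r {u, v} (v, k) = 0"
              by (metis distrib_left mult_zero_right)
            then show ?thesis using a[OF j(2), of u] a[OF j(2), of v] 2
              by (simp add: distrib_left sum.distrib)
          next
            case 3
            then show ?thesis using a[OF j(2), of x] by (simp add: r_def)
          qed simp
        qed
        finally show ?thesis .
      qed
      then show ?thesis
        using p unfolding independent_placement_def rows_independent_def K_def by blast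
    qed
    \<comment> \<open>Exactly the two edges \<open>{u, w}\<close> and \<open>{v, w}\<close> lie over
      the contracted edge \<open>{u, w}\<close>, so only their sum is controlled so far.\<close>
    have a_W: "a {u, w} + a {v, w} = 0" if "w \<in> W" for w
    proof -
      have w: "{u, w} \<in> E" "{v, w} \<in> E" using that by (auto simp: W_def common_neighbours_def)
      then have uw: "w \<noteq> u" "w \<noteq> v" using simple_edges_distinct[OF E] by blast+
      then have w0: "{u, w} \<in> E0" "{v, w} \<in> E0" using w \<open>u \<noteq> v\<close> by (auto simp: E0_def doubleton_eq_iff)
      have m: "m ` {u, w} = {u, w}" "m ` {v, w} = {u, w}"
        using uw \<open>u \<noteq> v\<close> by (auto simp: m_def merge_vertex_def)
      have "{e \<in> E0. m ` e = {u, w}} \<subseteq> {{u, w}, {v, w}}"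
      proof
        fix e assume "e \<in> {e \<in> E0. m ` e = {u, w}}"
        then have e: "e \<in> E" "e \<noteq> {u, v}" "merge_vertex u v ` e = merge_vertex u v ` {u, w}"
          using m by (auto simp: E0_def m_def)
        show "e \<in> {{u, w}, {v, w}}"
        proof (cases "e = {u, w}")
          case False
          have "{u, w} \<noteq> {u, v}" using w0(1) by (simp add: E0_def)
          from merge_vertex_image_eqD[OF E e(1) w(1) e(2) this e(3) False] uw \<open>u \<noteq> v\<close>
          show ?thesis by (auto simp: doubleton_eq_iff)
        qed simp
      qed
      then have "{e \<in> E0. m ` e = {u, w}} = {{u, w}, {v, w}}" using w0 m by auto
      moreover have "{u, w} \<noteq> {v, w}" using uw \<open>u \<noteq> v\<close> by (auto simp: doubleton_eq_iff)
      ultimately have "a' {u, w} = a {u, w} + a {v, w}" unfolding a'_def by simp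
      moreover have "{u, w} \<in> contract u v E" unfolding contr using w0(1) m(1) by (metis imageI)
      ultimately show ?thesis using a' by auto
    qed
    \<comment> \<open>Any other edge is alone over its image, so its own coefficient
      vanishes.\<close>
    have a_other: "a e = 0" if e: "e \<in> E0" "\<And>w. w \<in> W \<Longrightarrow> e \<noteq> {u, w} \<and> e \<noteq> {v, w}" for e
    proof -
      have "{f \<in> E0. m ` f = m ` e} = {e}"
      proof -
        have "f = e" if f: "f \<in> E0" "m ` f = m ` e" for f
        proof (rule ccontr)
          assume "f \<noteq> e"
          have "\<exists>w\<in>common_neighbours E u v. f = {u, w} \<and> e = {v, w} \<or> f = {v, w} \<and> e = {u, w}"
            by (rule merge_vertex_image_eqD[OF E]) (use f e \<open>f \<noteq> e\<close> in \<open>auto simp: E0_def m_def\<close>)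
          then show False using e(2) by (auto simp: W_def)
        qed
        then show ?thesis using e(1) by blast
      qed
      then have "a' (m ` e) = a e" by (simp add: a'_def)
      then show ?thesis using a' e(1) by (auto simp: contr)
    qed
    have finW: "finite W"
    proof (rule inj_on_finite)
      show "inj_on (\<lambda>w. {u, w}) W" by (auto simp: inj_on_def doubleton_eq_iff)
      show "(\<lambda>w. {u, w}) ` W \<subseteq> E" by (auto simp: W_def common_neighbours_def)
    qed (rule finE)
    have W0: "{u, w} \<in> E0" "w \<noteq> u" "w \<noteq> v" if "w \<in> W" for w
    proof -
      have w: "{u, w} \<in> E" "{v, w} \<in> E" using that by (auto simp: W_def common_neighbours_def)
      then show "w \<noteq> u" "w \<noteq> v" using simple_edges_distinct[OF E] by blast+
      then show "{u, w} \<in> E0" using w \<open>u \<noteq> v\<close> by (auto simp: E0_def doubleton_eq_iff)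
    qed
    have pw: "p u - p w \<noteq> 0" if "w \<in> W" for w
      using ne[OF W0(1)[OF that]] W0(2,3)[OF that] \<open>u \<noteq> v\<close> by (simp add: m_def merge_vertex_def)
    \<comment> \<open>This is the equation at the vertex \<open>u\<close>: by
      \<open>a_other\<close>, only \<open>{u, v}\<close> and the edges to common neighbours
      contribute. It is known on the basis and extends linearly to all vectors.\<close>
    define \<Phi> where "\<Phi> y = - a {u, v} * support_functional d y +
      (\<Sum>w\<in>W. a {u, w} * support_functional (p u - p w) y)" for y
    have "\<Phi> (b k) = 0" if "k \<in> K" for k
    proof -
      have "(\<Sum>e\<in>E0. a e * r e (u, k)) = (\<Sum>e\<in>(\<lambda>w. {u, w}) ` W. a e * r e (u, k))"
      proof (rule sum.mono_neutral_right)
        show "\<forall>e\<in>E0 - (\<lambda>w. {u, w}) ` W. a e * r e (u, k) = 0"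
        proof
          fix e assume e: "e \<in> E0 - (\<lambda>w. {u, w}) ` W"
          show "a e * r e (u, k) = 0"
          proof (cases "u \<in> e")
            case False
            then show ?thesis using e E0(3) by (auto simp: r_def rigidity_matrix_def)
          next
            case True
            have "e \<noteq> {u, w} \<and> e \<noteq> {v, w}" if "w \<in> W" for w
              using e that True W0(2)[OF that] \<open>u \<noteq> v\<close> by auto
            then show ?thesis using a_other e by simp
          qed
        qed
      qed (use E0 W0 in auto)
      also have "\<dots> = (\<Sum>w\<in>W. a {u, w} * r {u, w} (u, k))"
        by (subst sum.reindex) (auto simp: inj_on_def doubleton_eq_iff)
      also have "\<dots> = (\<Sum>w\<in>W. a {u, w} * support_functional (p u - p w) (b k))"
      proof (rule sum.cong)
        fix w assume w: "w \<in> W"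
        have "u \<noteq> w" "{u, w} \<noteq> {u, v}" using W0[OF w] \<open>u \<noteq> v\<close> by (auto simp: doubleton_eq_iff)
        then have "r {u, w} (u, k) = support_functional (p u - p w) (b k)"
          using W0(3)[OF w] \<open>u \<noteq> v\<close> rigidity_matrix_edge[of u w b "p \<circ> m" u k]
          by (simp add: r_def m_def merge_vertex_def)
        then show "a {u, w} * r {u, w} (u, k) = a {u, w} * support_functional (p u - p w) (b k)" by simp
      qed simp
      finally show ?thesis using a[OF that, of u] by (simp add: \<Phi>_def r_def)
    qed
    moreover have "bounded_linear \<Phi>"
      unfolding \<Phi>_def
      by (intro bounded_linear_add bounded_linear_sum bounded_linear_const_mult
          bounded_linear_support_functional[OF smooth] d(1) pw)
    ultimately have \<Phi>: "\<Phi> y = 0" for y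
      using linear_zero_on_basis[OF smooth basis, of \<Phi>] by (simp add: K_def bounded_linear.linear)
    \<comment> \<open>Evaluation at \<open>d\<close> removes all terms of common neighbours and
      isolates \<open>a {u, v}\<close> times the positive number
      \<open>support_functional d d\<close>.\<close>
    have "(\<Sum>w\<in>W. a {u, w} * support_functional (p u - p w) d) = 0"
      using d(2) by (simp add: W_def)
    then have a_uv: "a {u, v} = 0" using \<Phi>[of d] sf_d by (simp add: \<Phi>_def)
    have "\<forall>w\<in>W. a {u, w} = 0"
      unfolding W_def by (rule W) (use \<Phi> a_uv in \<open>simp add: \<Phi>_def W_def\<close>)
    then show "\<forall>e\<in>E. a e = 0"
      using a_uv a_W a_other E0(2) by (metis add_0 insertE)
  qed

  \<comment> \<open>From the limit back to an actual placement\<close>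
  have lim_q: "(\<lambda>n. q n x) \<longlonglongrightarrow> p (m x)" for x
  proof -
    have "(\<lambda>n. p u + (1 / real (Suc n)) *\<^sub>R d) \<longlonglongrightarrow> p u + 0 *\<^sub>R d"
      by (intro tendsto_intros lim_1_over_n LIMSEQ_Suc[OF lim_1_over_n])
    then show ?thesis by (cases "x = v") (simp_all add: q_def m_def merge_vertex_def)
  qed
  have conv: "(\<lambda>n. q n x - q n y) \<longlonglongrightarrow> p (m x) - p (m y)" for x y
    by (intro tendsto_intros lim_q)
  define R where "R n e j = (if e = {u, v} then real (Suc n) * rigidity_matrix b (q n) e j
      else rigidity_matrix b (q n) e j)" for n e j
  have "\<forall>\<^sub>F n in sequentially. rows_independent E (UNIV \<times> K) (R n)"
  proof (rule rows_independent_eventually[OF finE _ ind])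
    fix e j assume e: "e \<in> E" and "j \<in> (UNIV :: 'v set) \<times> K"
    then obtain x k where j: "j = (x, k)" by (meson surj_pair)
    show "(\<lambda>n. R n e j) \<longlonglongrightarrow> r e j"
    proof (cases "e = {u, v}")
      case True
      \<comment> \<open>By homogeneity the rescaled row of the short edge equals its limit for every
        n.\<close>
      have "q n u - q n v = (- 1 / real (Suc n)) *\<^sub>R d" "q n v - q n u = (1 / real (Suc n)) *\<^sub>R d" for n
        using \<open>u \<noteq> v\<close> by (simp_all add: q_def)
      then have "R n e j = r e j" for n
        using support_functional_scaleR[OF smooth d(1), of "- 1 / real (Suc n)"]
          support_functional_scaleR[OF smooth d(1), of "1 / real (Suc n)"]
        by (simp add: R_def r_def j True rigidity_matrix_edge[OF \<open>u \<noteq> v\<close>] del: of_nat_Suc)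
      then show ?thesis by simp
    next
      case False
      obtain y z where yz: "e = {y, z}" "y \<noteq> z" by (rule simple_edgesE[OF E e])
      then have "{y, z} \<in> E0" "{z, y} \<in> E0" using e False by (auto simp: E0_def insert_commute)
      then show ?thesis
        using False tendsto_support_functional[OF smooth basis conv ne]
        by (simp add: R_def r_def j yz(1) rigidity_matrix_edge[OF yz(2)])
    qed
  qed
  moreover have "\<forall>\<^sub>F n in sequentially. placement E (q n)"
  proof -
    have "\<forall>\<^sub>F n in sequentially. \<forall>e\<in>E0. \<forall>x y. e = {x, y} \<longrightarrow> q n x \<noteq> q n y"
    proof (rule eventually_ball_finite[OF E0(1)], rule ballI)
      fix e assume "e \<in> E0"
      then have "e \<in> E" using E0(2) by blast
      then obtain x y where xy: "e = {x, y}" by (rule simple_edgesE[OF E])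
      have "\<forall>\<^sub>F n in sequentially. q n x - q n y \<noteq> 0"
        using conv[of x y] ne[of x y] xy \<open>e \<in> E0\<close> by (intro tendsto_imp_eventually_ne) auto
      then show "\<forall>\<^sub>F n in sequentially. \<forall>x y. e = {x, y} \<longrightarrow> q n x \<noteq> q n y"
        by (rule eventually_mono) (auto simp: xy doubleton_eq_iff)
    qed
    moreover have "q n u \<noteq> q n v" for n using d(1) \<open>u \<noteq> v\<close> by (simp add: q_def)
    ultimately show ?thesis
      by (elim eventually_mono) (auto simp: placement_def E0(2) doubleton_eq_iff, metis)
  qed
  ultimately have "\<forall>\<^sub>F n in sequentially. rows_independent E (UNIV \<times> K) (R n) \<and> placement E (q n)"
    by (rule eventually_conj)
  then obtain n where n: "rows_independent E (UNIV \<times> K) (R n)" "placement E (q n)"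
    using eventually_happens' sequentially_bot by blast
  have "rows_independent E (UNIV \<times> K) (rigidity_matrix b (q n))"
    unfolding rows_independent_def
  proof (intro allI impI)
    fix a :: "'v set \<Rightarrow> real"
    assume a: "\<forall>j\<in>UNIV \<times> K. (\<Sum>e\<in>E. a e * rigidity_matrix b (q n) e j) = 0"
    define a' where "a' e = (if e = {u, v} then a e / real (Suc n) else a e)" for e
    have "a' e * R n e j = a e * rigidity_matrix b (q n) e j" for e j
      by (simp add: a'_def R_def)
    then have "\<forall>e\<in>E. a' e = 0" using n(1) a by (simp add: rows_independent_def)
    then show "\<forall>e\<in>E. a e = 0" by (auto simp: a'_def split: if_splits)
  qed
  then show ?thesis using n(2) unfolding independent_placement_def K_def by blast
qed

end

section \<open>Combinatorial planarity\<close>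

text \<open>For a two-element edge, oddness says that exactly one end lies in \<open>S\<close>; in
  parity form this is the coboundary of \<open>S\<close> mod 2.\<close>

definition edge_cut :: "'v set set \<Rightarrow> 'v set \<Rightarrow> 'v set set" where
  "edge_cut E S = {e\<in>E. odd (card (e \<inter> S))}"

text \<open>An indexed family, because two faces may be the same edge set, as the two sides of a
  single cycle are. The fourth clause puts the faces into the cycle space; the fifth says, by
  orthogonality, that they span it. An edge \<open>e\<close> on no face is a bridge, since
  \<open>{e}\<close> is then a cut.\<close>

definition face_system :: "'v set set \<Rightarrow> 'i set \<Rightarrow> ('i \<Rightarrow> 'v set set) \<Rightarrow> bool" where
  "face_system E I F \<longleftrightarrow> finite I \<and> (\<forall>i\<in>I. F i \<subseteq> E) \<and>
     (\<forall>e\<in>E. card {i\<in>I. e \<in> F i} \<in> {0, 2}) \<and>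
     (\<forall>i\<in>I. \<forall>S. even (card (F i \<inter> edge_cut E S))) \<and>
     (\<forall>c\<subseteq>E. (\<forall>i\<in>I. even (card (c \<inter> F i))) \<longrightarrow> (\<exists>S. c = edge_cut E S))"

definition planar_edges :: "'v set set \<Rightarrow> bool" where
  "planar_edges E \<longleftrightarrow> (\<exists>(I :: nat set) F. face_system E I F)"

lemma edge_cut_subset: "edge_cut E S \<subseteq> E"
  by (auto simp: edge_cut_def)

lemma even_card_sym_diff:
  assumes "finite D"
  shows "even (card (sym_diff A B \<inter> D)) \<longleftrightarrow> (even (card (A \<inter> D)) \<longleftrightarrow> even (card (B \<inter> D)))"
proof -
  have f: "finite (A \<inter> D)" "finite (B \<inter> D)" using assms by auto
  have "sym_diff A B \<inter> D = (A \<inter> D - B \<inter> D) \<union> (B \<inter> D - A \<inter> D)" by auto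
  then have "card (sym_diff A B \<inter> D) = card (A \<inter> D - B \<inter> D) + card (B \<inter> D - A \<inter> D)"
    using f by (simp only:) (rule card_Un_disjoint; auto)
  moreover have "card (A \<inter> D) = card (A \<inter> D - B \<inter> D) + card (A \<inter> D \<inter> (B \<inter> D))"
    using f(1) by (metis add.commute card_Int_Diff)
  moreover have "card (B \<inter> D) = card (B \<inter> D - A \<inter> D) + card (A \<inter> D \<inter> (B \<inter> D))"
    using f(2) by (metis add.commute card_Int_Diff Int_commute)
  ultimately show ?thesis by presburger
qed

lemma face_system_delete_outside:
  assumes fs: "face_system E I F" and e: "\<And>i. i \<in> I \<Longrightarrow> e \<notin> F i"
  shows "face_system (E - {e}) I F"
  unfolding face_system_def
proof (intro conjI ballI allI impI)
  show "finite I" using fs by (simp add: face_system_def)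
  fix i assume "i \<in> I"
  then show F: "F i \<subseteq> E - {e}" using fs e by (auto simp: face_system_def)
  fix S
  have "F i \<inter> edge_cut (E - {e}) S = F i \<inter> edge_cut E S" using F by (auto simp: edge_cut_def)
  then show "even (card (F i \<inter> edge_cut (E - {e}) S))" using fs \<open>i \<in> I\<close> by (simp add: face_system_def)
next
  fix f assume "f \<in> E - {e}"
  then show "card {i\<in>I. f \<in> F i} \<in> {0, 2}" using fs unfolding face_system_def by blast
next
  fix c assume c: "c \<subseteq> E - {e}" "\<forall>i\<in>I. even (card (c \<inter> F i))"
  then obtain S where "c = edge_cut E S" using fs unfolding face_system_def by blast
  then have "c = edge_cut (E - {e}) S" using c(1) by (auto simp: edge_cut_def)
  then show "\<exists>S. c = edge_cut (E - {e}) S" by blast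
qed

text \<open>Removing an edge between two faces joins them into one, on whose boundary the other
  shared edges cancel.\<close>

lemma face_system_delete_merge:
  assumes "finite E" and fs: "face_system E I F" and e: "{i\<in>I. e \<in> F i} = {j, k}" "j \<noteq> k" "e \<in> E"
  shows "face_system (E - {e}) (I - {k}) (F(j := sym_diff (F j) (F k)))" (is "face_system ?E ?I ?F")
  unfolding face_system_def
proof (intro conjI ballI allI impI)
  have jk: "j \<in> I" "k \<in> I" "e \<in> F j" "e \<in> F k" using e(1) by auto
  have out: "e \<notin> F i" if "i \<in> I" "i \<noteq> j" "i \<noteq> k" for i using e(1) that by blast
  have FE: "F i \<subseteq> E" if "i \<in> I" for i using fs that by (simp add: face_system_def)
  show "finite ?I" using fs by (simp add: face_system_def)
  {
    fix i assume i: "i \<in> ?I"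
    show F: "?F i \<subseteq> ?E" using i FE jk out by auto
    fix S
    have fin: "finite (edge_cut E S)" using assms(1) edge_cut_subset finite_subset by metis
    have even: "even (card (F l \<inter> edge_cut E S))" if "l \<in> I" for l
      using fs that by (simp add: face_system_def)
    have "?F i \<inter> edge_cut ?E S = ?F i \<inter> edge_cut E S" using F by (auto simp: edge_cut_def)
    moreover have "even (card (?F i \<inter> edge_cut E S))"
      using i even even[OF jk(1)] even[OF jk(2)] even_card_sym_diff[OF fin, of "F j" "F k"] by simp
    ultimately show "even (card (?F i \<inter> edge_cut ?E S))" by simp
  next
    fix f assume f: "f \<in> ?E"
    then have 2: "card {i\<in>I. f \<in> F i} \<in> {0, 2}" using fs unfolding face_system_def by blast
    have fin: "finite I" using fs by (simp add: face_system_def)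
    show "card {i\<in>?I. f \<in> ?F i} \<in> {0, 2}"
    proof (cases "f \<in> F k")
      case False
      then have "{i\<in>?I. f \<in> ?F i} = {i\<in>I. f \<in> F i}" using jk e(2) by auto
      then show ?thesis using 2 by simp
    next
      case True
      have "card {i\<in>I. f \<in> F i} \<noteq> 0" using True jk(2) fin by auto
      then have c2: "card {i\<in>I. f \<in> F i} = 2" using 2 by simp
      show ?thesis
      proof (cases "f \<in> F j")
        case True
        \<comment> \<open>Both faces of \<open>f\<close> are the merged ones, so \<open>f\<close>
          ends up on no face at all.\<close>
        have "{j, k} = {i\<in>I. f \<in> F i}"
          by (rule card_subset_eq) (use fin jk True \<open>f \<in> F k\<close> c2 e(2) in auto)
        then have emp: "{i\<in>?I. f \<in> ?F i} = {}" using True \<open>f \<in> F k\<close> by auto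
        show ?thesis unfolding emp by simp
      next
        case False
        then have ins: "{i\<in>?I. f \<in> ?F i} = insert j ({i\<in>I. f \<in> F i} - {k})"
          using True jk e(2) by auto
        moreover have "card ({i\<in>I. f \<in> F i} - {k}) = 1" using c2 True jk(2) by simp
        moreover have "j \<notin> {i\<in>I. f \<in> F i} - {k}" using False by simp
        ultimately show ?thesis unfolding ins using fin by simp
      qed
    qed
  next
    fix c assume c: "c \<subseteq> ?E" "\<forall>i\<in>?I. even (card (c \<inter> ?F i))"
    have finc: "finite c" using c(1) assms(1) finite_subset by blast
    have ec: "e \<notin> c" using c(1) by auto
    \<comment> \<open>Evenness on the merged face only says that \<open>c\<close> meets
      \<open>F j\<close> and \<open>F k\<close> with equal parity. If both are odd, putting
      \<open>e\<close> back corrects both at once, and \<open>e\<close> lies on no other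
      face.\<close>
    define c' where "c' = (if odd (card (c \<inter> F j)) then insert e c else c)"
    have jkc: "even (card (c \<inter> F j)) \<longleftrightarrow> even (card (c \<inter> F k))"
      using c(2)[rule_format, of j] jk(1) e(2) even_card_sym_diff[OF finc, of "F j" "F k"]
      by (simp add: Int_commute)
    have ins: "card (insert e c \<inter> F l) = Suc (card (c \<inter> F l))" if "e \<in> F l" for l
      using that ec finc by simp
    have "even (card (c' \<inter> F i))" if i: "i \<in> I" for i
    proof (cases "i = j \<or> i = k")
      case True
      then show ?thesis using jkc ins jk by (auto simp: c'_def)
    next
      case False
      then have "c' \<inter> F i = c \<inter> F i" using out[OF i] by (auto simp: c'_def)
      then show ?thesis using c(2)[rule_format, of i] i False by simp
    qed
    moreover have "c' \<subseteq> E" using c(1) e(3) by (auto simp: c'_def)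
    ultimately obtain S where "c' = edge_cut E S" using fs unfolding face_system_def by blast
    then have "c = edge_cut ?E S" using ec by (auto simp: c'_def edge_cut_def split: if_splits)
    then show "\<exists>S. c = edge_cut ?E S" by blast
  }
qed

lemma planar_edges_delete:
  assumes "finite E" "planar_edges E"
  shows "planar_edges (E - {e})"
proof (cases "e \<in> E")
  case True
  obtain I :: "nat set" and F where fs: "face_system E I F" using assms(2) by (auto simp: planar_edges_def)
  then have "card {i\<in>I. e \<in> F i} = 0 \<or> card {i\<in>I. e \<in> F i} = 2"
    using True unfolding face_system_def by blast
  then show ?thesis
  proof
    assume "card {i\<in>I. e \<in> F i} = 0"
    moreover have "finite I" using fs by (simp add: face_system_def)
    ultimately have "e \<notin> F i" if "i \<in> I" for i using that by auto
    then show ?thesis using face_system_delete_outside[OF fs] by (auto simp: planar_edges_def)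
  next
    assume "card {i\<in>I. e \<in> F i} = 2"
    then obtain j k where "{i\<in>I. e \<in> F i} = {j, k}" "j \<noteq> k" by (meson card_2_iff)
    then show ?thesis using face_system_delete_merge[OF assms(1) fs _ _ True, of j k] unfolding planar_edges_def by blast
  qed
qed (use assms in simp)

lemma planar_edges_subset:
  assumes "finite E" "planar_edges E" "E' \<subseteq> E"
  shows "planar_edges E'"
proof -
  have "planar_edges (E - D)" if "finite D" for D
    using that
  proof (induction D rule: finite_induct)
    case (insert x D)
    have "E - insert x D = (E - D) - {x}" by auto
    then show ?case using insert planar_edges_delete[of "E - D" x] assms(1) by simp
  qed (use assms in simp)
  moreover have "E' = E - (E - E')" using assms by auto
  ultimately show ?thesis using assms(1) by (metis finite_Diff)
qed

text \<open>Once merging is injective on edges, faces and cuts are carried along it. The cuts of the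
  contracted graph are the cuts of \<open>E1\<close> that do not separate \<open>u\<close> from
  \<open>v\<close>, that is, those avoiding \<open>{u, v}\<close>.\<close>

lemma planar_edges_contract:
  assumes E: "simple_edges E" and planar: "planar_edges E" and uv: "{u, v} \<in> E"
  shows "planar_edges (contract u v E)"
proof -
  define m where "m = merge_vertex u v"
  (* these deletions make the contraction injective on the edges other than {u, v} *)
  define E1 where "E1 = E - (\<lambda>w. {v, w}) ` common_neighbours E u v"
  define E0 where "E0 = E1 - {{u, v}}"
  have "u \<noteq> v" using simple_edges_distinct[OF E uv] .
  have E1: "E1 \<subseteq> E" "simple_edges E1" "finite E1"
    using simple_edges_subset[OF E, of E1] by (auto simp: E1_def simple_edges_def)
  have inj: "inj_on (image m) E0"
  proof (rule inj_onI, rule ccontr)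
    fix e e' assume e: "e \<in> E0" "e' \<in> E0" "m ` e = m ` e'" "e \<noteq> e'"
    have "\<exists>w\<in>common_neighbours E u v. e = {u, w} \<and> e' = {v, w} \<or> e = {v, w} \<and> e' = {u, w}"
      by (rule merge_vertex_image_eqD[OF E]) (use e in \<open>auto simp: E0_def E1_def m_def\<close>)
    then show False using e(1,2) by (auto simp: E0_def E1_def)
  qed
  have contr: "contract u v E = image m ` E0"
  proof
    show "image m ` E0 \<subseteq> contract u v E" using E1(1) by (auto simp: contract_def E0_def m_def)
    show "contract u v E \<subseteq> image m ` E0"
    proof
      fix f assume "f \<in> contract u v E"
      then obtain e where e: "e \<in> E" "e \<noteq> {u, v}" "f = m ` e" by (auto simp: contract_def m_def)
      show "f \<in> image m ` E0"
      proof (cases "e \<in> E1")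
        case True
        then show ?thesis using e by (auto simp: E0_def)
      next
        case False
        then obtain w where w: "e = {v, w}" "{u, w} \<in> E" "{v, w} \<in> E"
          using e by (auto simp: E1_def common_neighbours_def)
        then have ne: "w \<noteq> u" "w \<noteq> v" using simple_edges_distinct[OF E] by blast+
        then have "{u, w} \<in> E0" using w(2) \<open>u \<noteq> v\<close> by (auto simp: E0_def E1_def doubleton_eq_iff)
        moreover have "f = m ` {u, w}" using w e(3) ne \<open>u \<noteq> v\<close> by (auto simp: m_def merge_vertex_def)
        ultimately show ?thesis by blast
      qed
    qed
  qed
  have "planar_edges E1" using planar_edges_subset[OF _ planar E1(1)] E by (simp add: simple_edges_def)
  then obtain I :: "nat set" and F where fs: "face_system E1 I F" by (auto simp: planar_edges_def)
  have FE: "F i \<subseteq> E1" if "i \<in> I" for i using fs that by (simp add: face_system_def)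
  have card_m: "card (m ` e \<inter> S) = card (e \<inter> m -` S)" if e: "e \<in> E0" for e S
  proof -
    have "e \<in> E1" using e by (simp add: E0_def)
    then obtain x y where xy: "e = {x, y}" "x \<noteq> y" by (rule simple_edgesE[OF E1(2)])
    have "{x, y} \<noteq> {u, v}" using e xy(1) by (simp add: E0_def)
    then have "m x \<noteq> m y" unfolding m_def using xy(2) by (rule merge_vertex_distinct)
    then have "inj_on m (e \<inter> m -` S)" by (auto simp: inj_on_def xy(1))
    moreover have "m ` (e \<inter> m -` S) = m ` e \<inter> S" by auto
    ultimately show ?thesis by (metis card_image)
  qed
  have cut_m: "edge_cut (image m ` E0) S = image m ` edge_cut E0 (m -` S)" for S
    using card_m by (auto simp: edge_cut_def)
  define G where "G i = image m ` (F i - {{u, v}})" for i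
  have "face_system (image m ` E0) I G"
    unfolding face_system_def
  proof (intro conjI ballI allI impI)
    show "finite I" using fs by (simp add: face_system_def)
  next
    fix i assume "i \<in> I"
    then show "G i \<subseteq> image m ` E0" using FE by (auto simp: G_def E0_def)
  next
    fix f assume "f \<in> image m ` E0"
    then obtain e where e: "e \<in> E0" "f = m ` e" by auto
    have "f \<in> G i \<longleftrightarrow> e \<in> F i" if "i \<in> I" for i
    proof -
      have sub: "F i - {{u, v}} \<subseteq> E0" using FE[OF that] by (auto simp: E0_def)
      have "f \<in> G i \<longleftrightarrow> e \<in> F i - {{u, v}}"
        unfolding G_def e(2) by (rule inj_on_image_mem_iff[OF inj e(1) sub])
      then show ?thesis using e(1) by (simp add: E0_def)
    qed
    then have "{i\<in>I. f \<in> G i} = {i\<in>I. e \<in> F i}" by auto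
    moreover have "e \<in> E1" using e(1) by (simp add: E0_def)
    ultimately show "card {i\<in>I. f \<in> G i} \<in> {0, 2}" using fs unfolding face_system_def by metis
  next
    fix i S assume "i \<in> I"
    define T where "T = m -` S"
    have sub: "F i - {{u, v}} \<subseteq> E0" using FE[OF \<open>i \<in> I\<close>] by (auto simp: E0_def)
    have "u \<in> T \<longleftrightarrow> v \<in> T" by (simp add: T_def m_def merge_vertex_def)
    then have "{u, v} \<inter> T = {} \<or> {u, v} \<inter> T = {u, v}" by auto
    then have "even (card ({u, v} \<inter> T))" using \<open>u \<noteq> v\<close> by (elim disjE) simp_all
    then have "{u, v} \<notin> edge_cut E1 T" by (simp add: edge_cut_def)
    then have eq: "(F i - {{u, v}}) \<inter> edge_cut E0 T = F i \<inter> edge_cut E1 T"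
      using sub by (auto simp: edge_cut_def E0_def)
    have "G i \<inter> edge_cut (image m ` E0) S = image m ` ((F i - {{u, v}}) \<inter> edge_cut E0 T)"
      unfolding G_def cut_m T_def
      by (rule inj_on_image_Int[OF inj sub edge_cut_subset, symmetric])
    then have "card (G i \<inter> edge_cut (image m ` E0) S) = card (F i \<inter> edge_cut E1 T)"
      unfolding eq using card_image[OF inj_on_subset[OF inj]] sub eq by (metis inf.coboundedI1)
    then show "even (card (G i \<inter> edge_cut (image m ` E0) S))"
      using fs \<open>i \<in> I\<close> by (simp add: face_system_def)
  next
    fix c assume c: "c \<subseteq> image m ` E0" "\<forall>i\<in>I. even (card (c \<inter> G i))"
    define d where "d = {e\<in>E0. m ` e \<in> c}"
    have cd: "c = image m ` d" "d \<subseteq> E0" using c(1) by (auto simp: d_def)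
    have "even (card (d \<inter> F i))" if "i \<in> I" for i
    proof -
      have sub: "F i - {{u, v}} \<subseteq> E0" using FE[OF that] by (auto simp: E0_def)
      have "c \<inter> G i = image m ` (d \<inter> (F i - {{u, v}}))"
        unfolding cd(1) G_def by (rule inj_on_image_Int[OF inj cd(2) sub, symmetric])
      also have "d \<inter> (F i - {{u, v}}) = d \<inter> F i" using cd(2) by (auto simp: E0_def)
      finally have "c \<inter> G i = image m ` (d \<inter> F i)" .
      moreover have "inj_on (image m) (d \<inter> F i)"
        by (rule inj_on_subset[OF inj]) (use cd(2) in blast)
      ultimately have "card (c \<inter> G i) = card (d \<inter> F i)" by (simp only: card_image)
      then show ?thesis using c(2)[rule_format, OF that] by simp
    qed
    moreover have "d \<subseteq> E1" using cd(2) by (auto simp: E0_def)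
    ultimately obtain S where S: "d = edge_cut E1 S" using fs unfolding face_system_def by blast
    \<comment> \<open>The edge \<open>{u, v}\<close> belongs to \<open>E1\<close> but not to
      \<open>d\<close>, so \<open>S\<close> contains both of its ends or neither.\<close>
    have "m -` S = S"
    proof -
      have "u \<in> S \<longleftrightarrow> v \<in> S"
      proof (rule ccontr)
        assume "\<not> ?thesis"
        then have "{u, v} \<inter> S = {u} \<or> {u, v} \<inter> S = {v}" by auto
        then have "odd (card ({u, v} \<inter> S))" by (elim disjE) simp_all
        moreover have "{u, v} \<in> E1"
        proof -
          have "{u, v} \<noteq> {v, w}" if "w \<in> common_neighbours E u v" for w
            using that simple_edges_distinct[OF E, of u w] \<open>u \<noteq> v\<close>
            by (auto simp: common_neighbours_def doubleton_eq_iff)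
          then show ?thesis using uv by (auto simp: E1_def)
        qed
        ultimately have "{u, v} \<in> d" by (simp add: S edge_cut_def)
        then show False using cd(2) by (auto simp: E0_def)
      qed
      then show ?thesis by (auto simp: m_def merge_vertex_def split: if_splits)
    qed
    moreover have "d = edge_cut E0 S" using S cd(2) by (auto simp: edge_cut_def E0_def)
    ultimately have "c = edge_cut (image m ` E0) S" by (simp add: cut_m cd(1))
    then show "\<exists>S. c = edge_cut (image m ` E0) S" by blast
  qed
  then show ?thesis unfolding contr planar_edges_def by blast
qed

section \<open>Counting edges, faces and cuts\<close>

lemma card_le_card_fibres:
  assumes "finite A" "finite B" "f ` A \<subseteq> B" "\<And>y. y \<in> B \<Longrightarrow> card {x\<in>A. f x = y} \<le> k"
  shows "card A \<le> card B * k"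
proof -
  have "A = (\<Union>y\<in>B. {x\<in>A. f x = y})" using assms(3) by auto
  then have "card A \<le> (\<Sum>y\<in>B. card {x\<in>A. f x = y})"
    using card_UN_le[OF assms(2), of "\<lambda>y. {x\<in>A. f x = y}"] by simp
  also have "\<dots> \<le> (\<Sum>y\<in>B. k)" by (rule sum_mono) (rule assms(4))
  finally show ?thesis by simp
qed

lemma sum_card_Int_faces:
  assumes "finite I" "finite c"
  shows "(\<Sum>i\<in>I. card (c \<inter> F i)) = (\<Sum>e\<in>c. card {i\<in>I. e \<in> F i})"
proof -
  have "(\<Sum>i\<in>I. card {e\<in>c. e \<in> F i}) = (\<Sum>e\<in>c. card {i\<in>I. e \<in> F i})"
    by (rule sum_multicount_gen) (use assms in auto)
  then show ?thesis by (simp add: Int_def)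
qed

text \<open>Orthogonality to the cut of a single vertex forbids exactly one edge at that vertex. So
  both ends of an edge of \<open>F\<close> carry a further edge of \<open>F\<close>, and these two
  differ because there are no double edges.\<close>

lemma card_face_ge_3:
  assumes E: "simple_edges E" and F: "F \<subseteq> E" "F \<noteq> {}" "\<And>S. even (card (F \<inter> edge_cut E S))"
  shows "3 \<le> card F"
proof -
  have finF: "finite F" using E F(1) by (auto simp: simple_edges_def finite_subset)
  have other: "\<exists>e'\<in>F. e' \<noteq> e \<and> x \<in> e'" if e: "e \<in> F" "x \<in> e" for e x
  proof -
    have "f \<inter> {x} = (if x \<in> f then {x} else {})" for f by auto
    then have eq: "F \<inter> edge_cut E {x} = {f\<in>F. x \<in> f}" using F(1) by (auto simp: edge_cut_def)
    have "even (card {f\<in>F. x \<in> f})" using F(3)[of "{x}"] eq by simp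
    moreover have "card {f\<in>F. x \<in> f} = 1" if "{f\<in>F. x \<in> f} = {e}" unfolding that by simp
    ultimately have "{f\<in>F. x \<in> f} \<noteq> {e}" by fastforce
    then show ?thesis using e by blast
  qed
  obtain e where e: "e \<in> F" using F(2) by blast
  then have "e \<in> E" using F(1) by blast
  then obtain x y where xy: "e = {x, y}" "x \<noteq> y" by (rule simple_edgesE[OF E])
  obtain f where f: "f \<in> F" "f \<noteq> e" "x \<in> f" using other[OF e, of x] xy by auto
  obtain g where g: "g \<in> F" "g \<noteq> e" "y \<in> g" using other[OF e, of y] xy by auto
  have "f \<noteq> g"
  proof
    assume "f = g"
    then have "e \<subseteq> f" using f g xy by auto
    moreover have "card e = 2" "card f = 2" using E F(1) e f(1) by (auto simp: simple_edges_def)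
    moreover have "finite f" using \<open>card f = 2\<close> by (metis card.infinite zero_neq_numeral)
    ultimately have "e = f" by (simp add: card_subset_eq)
    then show False using f(2) by simp
  qed
  then have "card {e, f, g} = 3" using f g by simp
  moreover have "card {e, f, g} \<le> card F" using e f g finF by (intro card_mono) auto
  ultimately show ?thesis by simp
qed

text \<open>Euler's inequality by counting over the field with two elements: the faces impose at
  most \<open>card I - 1\<close> independent parity conditions on edge sets, and the solutions are
  cuts, of which there are at most \<open>2 ^ (card V - 1)\<close>. So |E| is at most |I| + |V| - 2,
  and 3 |I| is at most 2 |E|.\<close>

lemma planar_edges_card_le:
  assumes E: "simple_edges E" and planar: "planar_edges E"
    and V: "finite V" "\<Union>E \<subseteq> V" "3 \<le> card V"
  shows "card E + 6 \<le> 3 * card V"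
proof -
  obtain I' :: "nat set" and F where fs: "face_system E I' F" using planar by (auto simp: planar_edges_def)
  define I where "I = {i\<in>I'. F i \<noteq> {}}"
  have finE: "finite E" using E by (simp add: simple_edges_def)
  have finI: "finite I" using fs by (simp add: I_def face_system_def)
  have FE: "F i \<subseteq> E" "finite (F i)" if "i \<in> I" for i
    using that fs finE finite_subset by (auto simp: I_def face_system_def)
  have even_F: "even (card (F i \<inter> edge_cut E S))" if "i \<in> I" for i S
    using that fs by (simp add: I_def face_system_def)
  have two: "card {i\<in>I. e \<in> F i} = 0 \<or> card {i\<in>I. e \<in> F i} = 2" if "e \<in> E" for e
  proof -
    have "{i\<in>I. e \<in> F i} = {i\<in>I'. e \<in> F i}" by (auto simp: I_def)
    then show ?thesis using fs that unfolding face_system_def by auto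
  qed
  have "3 * card I = (\<Sum>i\<in>I. 3)" by simp
  also have "\<dots> \<le> (\<Sum>i\<in>I. card (E \<inter> F i))"
  proof (rule sum_mono)
    fix i assume i: "i \<in> I"
    then have "F i \<noteq> {}" by (simp add: I_def)
    then have "3 \<le> card (F i)" using card_face_ge_3[OF E FE(1)[OF i]] even_F[OF i] by blast
    moreover have "E \<inter> F i = F i" using FE(1)[OF i] by auto
    ultimately show "3 \<le> card (E \<inter> F i)" by simp
  qed
  also have "\<dots> = (\<Sum>e\<in>E. card {i\<in>I. e \<in> F i})" by (rule sum_card_Int_faces[OF finI finE])
  also have "\<dots> \<le> (\<Sum>e\<in>E. 2)" by (rule sum_mono) (use two in fastforce)
  finally have faces: "3 * card I \<le> 2 * card E" by simp

  define Z where "Z = {c\<in>Pow E. \<forall>i\<in>I. even (card (c \<inter> F i))}"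
  have finZ: "finite Z" using finE by (simp add: Z_def)
  obtain v0 where v0: "v0 \<in> V" using V(3) by fastforce
  \<comment> \<open>Complementary vertex sets have the same cut, so \<open>S\<close> may be chosen
    to avoid \<open>v0\<close>, which halves the count.\<close>
  have "Z \<subseteq> edge_cut E ` Pow (V - {v0})"
  proof
    fix c assume "c \<in> Z"
    then have c: "c \<subseteq> E" "\<forall>i\<in>I. even (card (c \<inter> F i))" by (auto simp: Z_def)
    then have "\<forall>i\<in>I'. even (card (c \<inter> F i))" by (auto simp: I_def)
    then obtain S where S: "c = edge_cut E S" using fs c(1) unfolding face_system_def by blast
    have eV: "e \<subseteq> V" if "e \<in> E" for e using that V(2) by blast
    show "c \<in> edge_cut E ` Pow (V - {v0})"
    proof (cases "v0 \<in> S")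
      case True
      have "odd (card (e \<inter> (V - S))) \<longleftrightarrow> odd (card (e \<inter> S))" if e: "e \<in> E" for e
      proof -
        have "finite e" using eV[OF e] V(1) finite_subset by blast
        then have "card e = card (e \<inter> S) + card (e - S)" by (metis add.commute card_Int_Diff)
        moreover have "e \<inter> (V - S) = e - S" using eV[OF e] by auto
        moreover have "card e = 2" using E e by (simp add: simple_edges_def)
        ultimately show ?thesis by (metis even_add even_numeral)
      qed
      then have "c = edge_cut E (V - S)" by (auto simp: S edge_cut_def)
      then show ?thesis using True by blast
    next
      case False
      have "e \<inter> (S \<inter> V) = e \<inter> S" if "e \<in> E" for e using eV[OF that] by auto
      then have "c = edge_cut E (S \<inter> V)" by (auto simp: S edge_cut_def)
      then show ?thesis using False by blast
    qed
  qed
  then have "card Z \<le> card (edge_cut E ` Pow (V - {v0}))" using V(1) by (intro card_mono) auto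
  also have "\<dots> \<le> card (Pow (V - {v0}))" using V(1) by (intro card_image_le) simp
  also have "\<dots> = 2 ^ (card V - 1)" using V(1) v0 by (simp add: card_Pow)
  finally have Z_le: "card Z \<le> 2 ^ (card V - 1)" .

  show ?thesis
  proof (cases "I = {}")
    \<comment> \<open>Without faces every edge set is a cut; the general count fails here as it sets
      one face apart.\<close>
    case True
    then have "Z = Pow E" by (simp add: Z_def Pow_def)
    then have "2 ^ card E \<le> (2 :: nat) ^ (card V - 1)" using Z_le finE by (simp add: card_Pow)
    then have "card E \<le> card V - 1" by (rule power_le_imp_le_exp[rotated]) simp
    then show ?thesis using V(3) by simp
  next
    case False
    then obtain i0 where i0: "i0 \<in> I" by blast
    \<comment> \<open>The parity at \<open>i0\<close> is omitted: each edge lies on none or two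
      faces, so the parities over all faces sum to an even number (\<open>total\<close>) and the
      others determine it.\<close>
    define par where "par c = {i\<in>I - {i0}. odd (card (c \<inter> F i))}" for c
    have total: "even (\<Sum>i\<in>I. card (c \<inter> F i))" if "c \<subseteq> E" for c
    proof -
      have "finite c" using that finE finite_subset by blast
      moreover have "even (\<Sum>e\<in>c. card {i\<in>I. e \<in> F i})"
        by (rule dvd_sum) (use two that in fastforce)
      ultimately show ?thesis using sum_card_Int_faces[OF finI, of c F] by simp
    qed
    have "card (Pow E) \<le> card (Pow (I - {i0})) * card Z"
    proof (rule card_le_card_fibres)
      show "par ` Pow E \<subseteq> Pow (I - {i0})" by (auto simp: par_def)
      fix A assume "A \<in> Pow (I - {i0})"
      show "card {c \<in> Pow E. par c = A} \<le> card Z"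
      proof (cases "{c \<in> Pow E. par c = A} = {}")
        case False
        then obtain c0 where c0: "c0 \<subseteq> E" "par c0 = A" by auto
        \<comment> \<open>A nonempty fibre of \<open>par\<close> is a translate of a subset of
          \<open>Z\<close>, hence no larger than \<open>Z\<close>.\<close>
        have "sym_diff c c0 \<in> Z" if c: "c \<subseteq> E" "par c = A" for c
        proof -
          have D: "sym_diff c c0 \<subseteq> E" using c(1) c0(1) by auto
          have sd: "even (card (sym_diff c c0 \<inter> F i)) \<longleftrightarrow>
              (even (card (c \<inter> F i)) \<longleftrightarrow> even (card (c0 \<inter> F i)))" if "i \<in> I" for i
            using even_card_sym_diff[OF FE(2)[OF that]] .
          have *: "even (card (sym_diff c c0 \<inter> F i))" if i: "i \<in> I - {i0}" for i
          proof -
            have "i \<in> par c \<longleftrightarrow> i \<in> par c0" using c(2) c0(2) by simp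
            then show ?thesis using sd[of i] i by (simp add: par_def)
          qed
          have "even (\<Sum>i\<in>I - {i0}. card (sym_diff c c0 \<inter> F i))"
            by (rule dvd_sum) (rule *)
          moreover have "(\<Sum>i\<in>I. card (sym_diff c c0 \<inter> F i)) =
              card (sym_diff c c0 \<inter> F i0) + (\<Sum>i\<in>I - {i0}. card (sym_diff c c0 \<inter> F i))"
            by (rule sum.remove[OF finI i0])
          ultimately have "even (card (sym_diff c c0 \<inter> F i0))" using total[OF D] by simp
          then have "\<forall>i\<in>I. even (card (sym_diff c c0 \<inter> F i))" using * by blast
          then show ?thesis using D unfolding Z_def by blast
        qed
        moreover have "inj_on (\<lambda>c. sym_diff c c0) {c \<in> Pow E. par c = A}"
          by (rule inj_onI) blast
        ultimately show ?thesis
          by (intro card_inj_on_le[of "\<lambda>c. sym_diff c c0"] finZ) blast+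
      next
        case True
        show ?thesis unfolding True by simp
      qed
    qed (use finE finI in auto)
    then have "2 ^ card E \<le> 2 ^ (card I - 1) * card Z"
      using finE finI i0 by (simp add: card_Pow)
    also have "\<dots> \<le> 2 ^ (card I - 1) * 2 ^ (card V - 1)" using Z_le by simp
    also have "\<dots> = (2 :: nat) ^ (card I - 1 + (card V - 1))" by (simp add: power_add)
    finally have "card E \<le> card I - 1 + (card V - 1)" by (rule power_le_imp_le_exp[rotated]) simp
    moreover have "card I \<ge> 1" using i0 finI by (metis One_nat_def Suc_leI card_gt_0_iff empty_iff)
    ultimately show ?thesis using faces V(3) by linarith
  qed
qed

definition neighbours :: "'v set set \<Rightarrow> 'v \<Rightarrow> 'v set" where
  "neighbours E x = {y. {x, y} \<in> E}"

lemma card_neighbours: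
  assumes E: "simple_edges E"
  shows "card (neighbours E x) = card {e\<in>E. x \<in> e}"
proof (rule bij_betw_same_card)
  show "bij_betw (\<lambda>y. {x, y}) (neighbours E x) {e\<in>E. x \<in> e}"
    unfolding bij_betw_def
  proof
    show "inj_on (\<lambda>y. {x, y}) (neighbours E x)" by (auto simp: inj_on_def doubleton_eq_iff)
    show "(\<lambda>y. {x, y}) ` neighbours E x = {e\<in>E. x \<in> e}"
    proof (rule set_eqI, rule iffI)
      fix e assume e: "e \<in> {e\<in>E. x \<in> e}"
      then have "e \<in> E" by simp
      then obtain y z where yz: "e = {y, z}" "y \<noteq> z" by (rule simple_edgesE[OF E])
      then show "e \<in> (\<lambda>y. {x, y}) ` neighbours E x"
        using e by (auto simp: neighbours_def insert_commute image_iff)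
    qed (auto simp: neighbours_def)
  qed
qed

lemma finite_neighbours:
  assumes "simple_edges E"
  shows "finite (neighbours E x)"
proof (rule inj_on_finite)
  show "inj_on (\<lambda>y. {x, y}) (neighbours E x)" by (auto simp: inj_on_def doubleton_eq_iff)
  show "(\<lambda>y. {x, y}) ` neighbours E x \<subseteq> E" by (auto simp: neighbours_def)
  show "finite E" using assms by (simp add: simple_edges_def)
qed

lemma handshake:
  assumes E: "simple_edges E" and V: "finite V" "\<Union>E \<subseteq> V"
  shows "(\<Sum>x\<in>V. card (neighbours E x)) = 2 * card E"
proof -
  have "(\<Sum>x\<in>V. card {e\<in>E. x \<in> e}) = (\<Sum>e\<in>E. 2)"
  proof (rule sum_multicount_gen[OF V(1)])
    show "finite E" using E by (simp add: simple_edges_def)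
    show "\<forall>e\<in>E. card {x\<in>V. x \<in> e} = 2"
    proof
      fix e assume e: "e \<in> E"
      then have "{x\<in>V. x \<in> e} = e" using V(2) by blast
      then show "card {x\<in>V. x \<in> e} = 2" using E e by (simp add: simple_edges_def)
    qed
  qed
  then show ?thesis using card_neighbours[OF E] by simp
qed

lemma common_neighbours_eq: "common_neighbours E u v = neighbours E u \<inter> neighbours E v"
  by (auto simp: common_neighbours_def neighbours_def)

text \<open>Otherwise some vertex \<open>a\<close> has n neighbours with n at most 5, each adjacent
  to three of the others, so 3 n is at most 2 |EN|. The edge bound on \<open>a\<close> with its
  neighbours gives n + |EN| + 6 at most 3 (n + 1). Together these force n to be at least 6.\<close>

lemma planar_edges_sparse_edge:
  assumes E: "simple_edges E" and planar: "planar_edges E" and "E \<noteq> {}"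
  shows "\<exists>u v. {u, v} \<in> E \<and> card (common_neighbours E u v) \<le> 2"
proof (rule ccontr)
  assume "\<not> ?thesis"
  then have dense: "3 \<le> card (common_neighbours E u v)" if "{u, v} \<in> E" for u v
    using that by (metis not_less_eq_eq numeral_2_eq_2 numeral_3_eq_3)
  define V where "V = \<Union>E"
  have finE: "finite E" using E by (simp add: simple_edges_def)
  have finV: "finite V" using E unfolding V_def simple_edges_def
    by (metis card.infinite finite_Union zero_neq_numeral)
  \<comment> \<open>A neighbour \<open>y\<close> of \<open>x\<close> and three common neighbours of
    \<open>x\<close> and \<open>y\<close> make four; this also supplies the three vertices that the
    edge bound requires.\<close>
  have deg: "4 \<le> card (neighbours E x)" if x: "x \<in> V" for x
  proof -
    obtain e where e: "e \<in> E" "x \<in> e" using x unfolding V_def by blast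
    obtain y' z where yz: "e = {y', z}" by (rule simple_edgesE[OF E e(1)])
    define y where "y = (if x = y' then z else y')"
    have y: "e = {x, y}" using e(2) yz by (auto simp: y_def)
    have "y \<notin> common_neighbours E x y"
      using simple_edges_distinct[OF E, of y y] by (auto simp: common_neighbours_def)
    moreover have "insert y (common_neighbours E x y) \<subseteq> neighbours E x"
      using e y by (auto simp: common_neighbours_eq neighbours_def)
    moreover have "finite (common_neighbours E x y)"
      unfolding common_neighbours_eq using finite_neighbours[OF E] by blast
    ultimately show ?thesis
      using dense[of x y] e y card_mono[OF finite_neighbours[OF E], of "insert y (common_neighbours E x y)" x]
      by simp
  qed
  have nbV: "neighbours E x \<subseteq> V" for x by (auto simp: neighbours_def V_def)
  obtain x0 where "x0 \<in> V" using \<open>E \<noteq> {}\<close> E unfolding V_def simple_edges_def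
    by (metis Union_iff card.empty all_not_in_conv zero_neq_numeral)
  then have "4 \<le> card V" using deg card_mono[OF finV nbV] order.trans by blast
  then have bound: "card E + 6 \<le> 3 * card V"
    using planar_edges_card_le[OF E planar finV] by (simp add: V_def)
  have "\<exists>a\<in>V. card (neighbours E a) \<le> 5"
  proof (rule ccontr)
    assume "\<not> ?thesis"
    then have "(\<Sum>x\<in>V. 6) \<le> (\<Sum>x\<in>V. card (neighbours E x))" by (intro sum_mono) force
    then show False using handshake[OF E finV] bound by (simp add: V_def)
  qed
  then obtain a where a: "a \<in> V" "card (neighbours E a) \<le> 5" by blast
  define N where "N = neighbours E a"
  define EN where "EN = {e\<in>E. e \<subseteq> N}"
  have finN: "finite N" unfolding N_def by (rule finite_neighbours[OF E])
  have aN: "a \<notin> N" using simple_edges_distinct[OF E, of a a] by (auto simp: N_def neighbours_def)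
  have EN: "simple_edges EN" using simple_edges_subset[OF E] by (auto simp: EN_def)
  have "(\<Sum>y\<in>N. 3) \<le> (\<Sum>y\<in>N. card (neighbours EN y))"
  proof (rule sum_mono)
    fix y assume y: "y \<in> N"
    have "common_neighbours E a y \<subseteq> neighbours EN y"
      using y by (auto simp: common_neighbours_def neighbours_def EN_def N_def)
    then have "card (common_neighbours E a y) \<le> card (neighbours EN y)"
      by (intro card_mono finite_neighbours[OF EN])
    then show "3 \<le> card (neighbours EN y)"
      using dense[of a y] y by (simp add: N_def neighbours_def)
  qed
  also have "\<dots> = 2 * card EN" by (rule handshake[OF EN finN]) (auto simp: EN_def)
  finally have 1: "3 * card N \<le> 2 * card EN" by simp
  define E' where "E' = {e\<in>E. a \<in> e} \<union> EN"
  have E': "E' \<subseteq> E" by (auto simp: E'_def EN_def)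
  have "\<Union>E' \<subseteq> insert a N"
  proof
    fix z assume "z \<in> \<Union>E'"
    then obtain e where e: "e \<in> E'" "z \<in> e" by blast
    show "z \<in> insert a N"
    proof (cases "e \<in> EN")
      case False
      then have ae: "e \<in> E" "a \<in> e" using e by (auto simp: E'_def)
      obtain x y where xy: "e = {x, y}" by (rule simple_edgesE[OF E ae(1)])
      then show ?thesis using ae e(2) by (auto simp: N_def neighbours_def insert_commute)
    qed (use e in \<open>auto simp: EN_def\<close>)
  qed
  moreover have "card (insert a N) = Suc (card N)" using aN finN by simp
  moreover have "4 \<le> card N" using deg a(1) by (simp add: N_def)
  ultimately have "card E' + 6 \<le> 3 * Suc (card N)"
    using planar_edges_card_le[OF simple_edges_subset[OF E E'] planar_edges_subset[OF finE planar E'],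
        of "insert a N"] finN by simp
  moreover have "card E' = card N + card EN"
  proof -
    have "card E' = card {e\<in>E. a \<in> e} + card EN"
      unfolding E'_def using finE aN by (intro card_Un_disjoint) (auto simp: EN_def)
    then show ?thesis using card_neighbours[OF E, of a] by (simp add: N_def)
  qed
  ultimately show False using 1 a(2) by (simp add: N_def)
qed

lemma planar_edges_independent_placement:
  fixes b :: "nat \<Rightarrow> 'x::real_normed_vector"
  assumes dim: "dim (UNIV :: 'x set) = 3" and smooth: "smooth_space TYPE('x)"
    and sc: "strictly_convex_space TYPE('x)" and basis: "basis_family b"
    and "simple_edges E" "planar_edges E"
  shows "\<exists>p. independent_placement b E p"
  using assms(5,6)
proof (induction "card E" arbitrary: E rule: less_induct)
  case less
  have finE: "finite E" using less.prems(1) by (simp add: simple_edges_def)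
  show ?case
  proof (cases "E = {}")
    case True
    then show ?thesis
      by (intro exI[of _ "\<lambda>_. 0"]) (simp add: independent_placement_def placement_def rows_independent_def)
  next
    case False
    then obtain u v where uv: "{u, v} \<in> E" and card: "card (common_neighbours E u v) \<le> 2"
      using planar_edges_sparse_edge[OF less.prems] by blast
    define W where "W = common_neighbours E u v"
    have "card (contract u v E) < card E"
    proof -
      have "card (contract u v E) \<le> card (E - {{u, v}})"
        unfolding contract_def using finE by (intro card_image_le) simp
      also have "\<dots> < card E" using uv finE by (intro psubset_card_mono) auto
      finally show ?thesis .
    qed
    then obtain p0 where p0: "independent_placement b (contract u v E) p0"
      using less.hyps simple_edges_contract[OF less.prems(1)] planar_edges_contract[OF less.prems uv] by blast
    have finW: "finite W"
      unfolding W_def common_neighbours_eq using finite_neighbours[OF less.prems(1)] by blast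
    have Wc: "{u, w} \<in> contract u v E" if "w \<in> W" for w
    proof -
      have w: "{u, w} \<in> E" "{v, w} \<in> E" using that by (auto simp: W_def common_neighbours_def)
      then have "w \<noteq> v" "u \<noteq> v" using simple_edges_distinct[OF less.prems(1)] uv by blast+
      then have "{u, w} = merge_vertex u v ` {u, w}" "{u, w} \<in> E - {{u, v}}"
        using w(1) by (auto simp: merge_vertex_def doubleton_eq_iff)
      then show ?thesis unfolding contract_def by blast
    qed
    obtain p where p: "independent_placement b (contract u v E) p"
      and gp: "\<And>\<alpha>. \<lbrakk>\<And>y. (\<Sum>w\<in>W. \<alpha> w * support_functional (p u - p w) y) = 0\<rbrakk> \<Longrightarrow> \<forall>w\<in>W. \<alpha> w = 0"
      using independent_placement_general_position[OF smooth basis sc dim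
          simple_edges_contract[OF less.prems(1)] p0 finW card[folded W_def] Wc] by blast
    have lin: "linear (support_functional (p u - p w))" if "w \<in> W" for w
    proof (rule linear_support_functional[OF smooth])
      show "p u - p w \<noteq> 0"
        using p Wc[OF that] by (auto simp: independent_placement_def placement_def)
    qed
    have "\<exists>d. d \<noteq> 0 \<and> (\<forall>w\<in>W. support_functional (p u - p w) d = 0)"
    proof -
      have "card W = 0 \<or> card W = 1 \<or> card W = 2" using card by (auto simp: W_def)
      then consider "W = {}" | w where "W = {w}" | w1 w2 where "W = {w1, w2}"
        using finW by (auto simp: card_1_singleton_iff card_2_iff)
      then show ?thesis
      proof cases
        case 1
        then show ?thesis
          using common_kernel_vector[OF dim basis linear_zero linear_zero] by auto
      next
        case 2
        then show ?thesis using common_kernel_vector[OF dim basis lin lin, of w w] by auto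
      next
        case 3
        then show ?thesis using common_kernel_vector[OF dim basis lin lin, of w1 w2] by auto
      qed
    qed
    then obtain d where d: "d \<noteq> 0" "\<And>w. w \<in> W \<Longrightarrow> support_functional (p u - p w) d = 0" by blast
    show ?thesis
      using vertex_split_independent[OF smooth basis less.prems(1) uv p gp[unfolded W_def] d[unfolded W_def]] .
  qed
qed

lemma graph_independent_if_independent_placement:
  fixes b :: "nat \<Rightarrow> 'x::real_normed_vector"
  assumes smooth: "smooth_space TYPE('x)" and E: "simple_edges E" "\<Union>E \<subseteq> V"
    and p: "independent_placement b E p"
  shows "graph_independent b V E"
proof -
  define K where "K = {1..dim (UNIV :: 'x set)}"
  have "well_positioned E p"
    using p smooth by (simp add: well_positioned_def independent_placement_def placement_def smooth_space_def)
  moreover have "framework_independent b V E p"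
    unfolding framework_independent_def K_def[symmetric]
  proof (intro allI impI)
    fix a :: "'a set \<Rightarrow> real"
    assume a: "\<forall>j\<in>V \<times> K. (\<Sum>e\<in>E. a e * rigidity_matrix b p e j) = 0"
    have "(\<Sum>e\<in>E. a e * rigidity_matrix b p e j) = 0" if j: "j \<in> UNIV \<times> K" for j
    proof (cases "fst j \<in> V")
      case True
      then show ?thesis using a j by (metis SigmaE SigmaI fst_conv)
    next
      case False
      then have "rigidity_matrix b p e j = 0" if "e \<in> E" for e
        using that E(2) by (auto simp: rigidity_matrix_def split: prod.splits)
      then show ?thesis by simp
    qed
    then show "\<forall>e\<in>E. a e = 0"
      using p unfolding independent_placement_def rows_independent_def K_def by blast
  qed
  ultimately show ?thesis
    using p unfolding graph_independent_def independent_placement_def by blast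
qed

section \<open>Sign cocycles on simply connected sets\<close>

text \<open>A multiplicative mod 2 Alexander-Spanier 1-cocycle at scale \<open>\<epsilon>\<close>:
  the identity is demanded only of triples that are pairwise close.\<close>

definition local_cocycle :: "'a::metric_space set \<Rightarrow> real \<Rightarrow> ('a \<Rightarrow> 'a \<Rightarrow> real) \<Rightarrow> bool" where
  "local_cocycle X \<epsilon> K \<longleftrightarrow> \<epsilon> > 0 \<and> (\<forall>x\<in>X. \<forall>y\<in>X. K x y \<in> {1, -1}) \<and>
     (\<forall>x\<in>X. \<forall>y\<in>X. \<forall>z\<in>X. dist x y < \<epsilon> \<longrightarrow> dist y z < \<epsilon> \<longrightarrow> dist x z < \<epsilon> \<longrightarrow> K x y * K y z = K x z)"

text \<open>Here \<open>s\<close> is a primitive of \<open>K\<close> at scale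
  \<open>\<delta>\<close>: on close pairs \<open>K\<close> is its coboundary.\<close>

definition trivialises :: "'a::metric_space set \<Rightarrow> real \<Rightarrow> ('a \<Rightarrow> 'a \<Rightarrow> real) \<Rightarrow> ('a \<Rightarrow> real) \<Rightarrow> bool" where
  "trivialises D \<delta> K s \<longleftrightarrow> \<delta> > 0 \<and> (\<forall>p\<in>D. s p \<in> {1, -1}) \<and>
     (\<forall>p\<in>D. \<forall>q\<in>D. dist p q < \<delta> \<longrightarrow> s q = s p * K p q)"

lemma trivialises_cong:
  assumes "trivialises D \<delta> K s" "\<And>p q. p \<in> D \<Longrightarrow> q \<in> D \<Longrightarrow> K p q = K' p q"
  shows "trivialises D \<delta> K' s"
  unfolding trivialises_def
proof (intro conjI ballI impI)
  fix p q assume pq: "p \<in> D" "q \<in> D" "dist p q < \<delta>"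
  then have "s q = s p * K p q" using assms(1) unfolding trivialises_def by blast
  then show "s q = s p * K' p q" using assms(2) pq by simp
next
  show "0 < \<delta>" using assms(1) by (simp only: trivialises_def)
  show "s p \<in> {1, -1}" if "p \<in> D" for p using assms(1) that unfolding trivialises_def by blast
qed

lemma local_cocycle_refl:
  assumes "local_cocycle X \<epsilon> K" "x \<in> X"
  shows "K x x = 1"
proof -
  have "\<epsilon> > 0" using assms(1) by (simp only: local_cocycle_def)
  then have "dist x x < \<epsilon>" by simp
  then have "K x x * K x x = K x x" using assms unfolding local_cocycle_def by blast
  moreover have "K x x \<in> {1, -1}" using assms unfolding local_cocycle_def by blast
  ultimately show ?thesis by auto
qed

text \<open>The primitive at \<open>p\<close> is the product of \<open>K\<close> along the
  subdivided segment from a base point to \<open>p\<close>; all segments use the same number of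
  steps, so two of them can be compared step by step.\<close>

lemma local_cocycle_trivial_on_convex:
  fixes D :: "'a::real_normed_vector set"
  assumes "convex D" "bounded D" and K: "local_cocycle D \<delta> K"
  shows "\<exists>s. trivialises D (\<delta> / 3) K s"
proof (cases "D = {}")
  case True
  then show ?thesis using K by (auto simp: trivialises_def local_cocycle_def)
next
  case False
  then obtain p0 where p0: "p0 \<in> D" by blast
  have \<delta>: "\<delta> > 0" using K by (simp add: local_cocycle_def)
  obtain B where B: "\<And>p. p \<in> D \<Longrightarrow> dist p0 p \<le> B"
    using \<open>bounded D\<close> bounded_any_center[of D p0] by auto
  obtain N :: nat where N: "3 * B / \<delta> < real N" "N > 0"
    using reals_Archimedean2[of "max (3 * B / \<delta>) 0"] by (metis max_less_iff_conj of_nat_0_less_iff)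
  define pt where "pt i p = p0 + (real i / real N) *\<^sub>R (p - p0)" for i p
  have ptD: "pt i p \<in> D" if "p \<in> D" "i \<le> N" for i p
  proof -
    have "pt i p = (1 - real i / real N) *\<^sub>R p0 + (real i / real N) *\<^sub>R p"
      by (simp add: pt_def algebra_simps)
    then show ?thesis using assms(1) p0 that N(2) unfolding convex_alt by auto
  qed
  have step: "dist (pt i p) (pt (Suc i) p) < \<delta> / 3" if "p \<in> D" for i p
  proof -
    have "pt (Suc i) p - pt i p = (1 / real N) *\<^sub>R (p - p0)"
      by (simp add: pt_def scaleR_left_diff_distrib[symmetric] diff_divide_distrib[symmetric])
    then have "dist (pt (Suc i) p) (pt i p) = dist p p0 / real N" by (simp add: dist_norm)
    then have "dist (pt i p) (pt (Suc i) p) = dist p0 p / real N" by (metis dist_commute)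
    also have "\<dots> \<le> B / real N" using B[OF that] by (simp add: divide_right_mono)
    also have "\<dots> < \<delta> / 3" using N \<delta> by (simp add: field_simps)
    finally show ?thesis .
  qed
  have across: "dist (pt i p) (pt i q) < \<delta> / 3" if "i \<le> N" "dist p q < \<delta> / 3" for i p q
  proof -
    have "pt i p - pt i q = (real i / real N) *\<^sub>R (p - q)" by (simp add: pt_def algebra_simps)
    then have "dist (pt i p) (pt i q) = (real i / real N) * dist p q" by (simp add: dist_norm)
    also have "\<dots> \<le> 1 * dist p q" using that(1) N(2) by (intro mult_right_mono) auto
    finally show ?thesis using that(2) by simp
  qed
  have tri: "K x y * K y z = K x z"
    if "x \<in> D" "y \<in> D" "z \<in> D" "dist x y < \<delta>" "dist y z < \<delta>" "dist x z < \<delta>" for x y z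
    using K that unfolding local_cocycle_def by blast
  have sgn: "K x y = 1 \<or> K x y = -1" if "x \<in> D" "y \<in> D" for x y
    using K that unfolding local_cocycle_def by blast
  define s where "s i p = (\<Prod>j<i. K (pt j p) (pt (Suc j) p))" for i p
  have s1: "s i p \<in> {1, -1}" if "p \<in> D" "i \<le> N" for i p
    using that(2)
  proof (induction i)
    case (Suc i)
    then have "K (pt i p) (pt (Suc i) p) = 1 \<or> K (pt i p) (pt (Suc i) p) = -1"
      using sgn ptD[OF that(1)] by simp
    then show ?case using Suc by (auto simp: s_def)
  qed (simp add: s_def)
  (* compares the segments from p0 to p and to q rung by rung *)
  have ladder: "s i q = s i p * K (pt i p) (pt i q)"
    if pq: "p \<in> D" "q \<in> D" "dist p q < \<delta> / 3" "i \<le> N" for i p q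
    using pq(4)
  proof (induction i)
    case 0
    then show ?case using local_cocycle_refl[OF K p0] by (simp add: s_def pt_def)
  next
    case (Suc i)
    note D = ptD[OF pq(1)] ptD[OF pq(2)]
    have d: "dist (pt i p) (pt (Suc i) p) < \<delta> / 3" "dist (pt i q) (pt (Suc i) q) < \<delta> / 3"
      "dist (pt i p) (pt i q) < \<delta> / 3" "dist (pt (Suc i) p) (pt (Suc i) q) < \<delta> / 3"
      using step pq across Suc.prems by simp_all
    \<comment> \<open>The diagonal cuts the square between two rungs into two triangles, and the
      cocycle identity is applied to each.\<close>
    have diag: "dist (pt i p) (pt (Suc i) q) < \<delta>"
      using dist_triangle[of "pt i p" "pt (Suc i) q" "pt i q"] d \<delta> by linarith
    have "s (Suc i) q = s i p * (K (pt i p) (pt i q) * K (pt i q) (pt (Suc i) q))"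
      using Suc by (simp add: s_def)
    also have "K (pt i p) (pt i q) * K (pt i q) (pt (Suc i) q) = K (pt i p) (pt (Suc i) q)"
      using D Suc.prems d diag \<delta> by (intro tri) simp_all
    also have "\<dots> = K (pt i p) (pt (Suc i) p) * K (pt (Suc i) p) (pt (Suc i) q)"
      using D Suc.prems d diag \<delta> by (intro tri[symmetric]) simp_all
    finally show ?case by (simp add: s_def)
  qed
  have "pt N p = p" for p using N(2) by (simp add: pt_def)
  then have pt_N: "s N q = s N p * K p q" if "p \<in> D" "q \<in> D" "dist p q < \<delta> / 3" for p q
    using ladder[OF that, of N] by simp
  then have "trivialises D (\<delta> / 3) K (s N)"
    unfolding trivialises_def
  proof (intro conjI ballI impI)
    show "\<delta> / 3 > 0" using \<delta> by simp
    show "s N p \<in> {1, -1}" if "p \<in> D" for p using s1[OF that] by simp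
  qed (rule pt_N)
  then show ?thesis by blast
qed

lemma local_cocycle_pullback_trivial:
  fixes f :: "'a::real_normed_vector \<Rightarrow> 'b::metric_space"
  assumes D: "convex D" "compact D" and f: "continuous_on D f" "f ` D \<subseteq> X"
    and K: "local_cocycle X \<epsilon> K"
  shows "\<exists>s \<delta>. trivialises D \<delta> (\<lambda>p q. K (f p) (f q)) s"
proof -
  have "\<epsilon> > 0" using K by (simp add: local_cocycle_def)
  then obtain \<delta> where \<delta>: "\<delta> > 0" "\<And>p q. p \<in> D \<Longrightarrow> q \<in> D \<Longrightarrow> dist p q < \<delta> \<Longrightarrow> dist (f p) (f q) < \<epsilon>"
    using compact_uniformly_continuous[OF f(1) D(2)] unfolding uniformly_continuous_on_def by metis
  have fX: "f p \<in> X" if "p \<in> D" for p using f(2) that by blast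
  have "local_cocycle D \<delta> (\<lambda>p q. K (f p) (f q))"
    unfolding local_cocycle_def
  proof (intro conjI ballI impI)
    show "K (f p) (f q) \<in> {1, -1}" if "p \<in> D" "q \<in> D" for p q
      using K fX[OF that(1)] fX[OF that(2)] unfolding local_cocycle_def by blast
  next
    fix p q r assume D: "p \<in> D" "q \<in> D" "r \<in> D" and "dist p q < \<delta>" "dist q r < \<delta>" "dist p r < \<delta>"
    then have "dist (f p) (f q) < \<epsilon>" "dist (f q) (f r) < \<epsilon>" "dist (f p) (f r) < \<epsilon>"
      using \<delta>(2) by blast+
    then show "K (f p) (f q) * K (f q) (f r) = K (f p) (f r)"
      using K fX[OF D(1)] fX[OF D(2)] fX[OF D(3)] unfolding local_cocycle_def by blast
  qed (rule \<delta>(1))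
  then show ?thesis using local_cocycle_trivial_on_convex[OF D(1) compact_imp_bounded[OF D(2)]] by blast
qed

text \<open>For signs the product is the quotient. It is locally constant because the factor
  \<open>K x y\<close> enters squared.\<close>

lemma trivialisations_proportional:
  assumes "connected D" and s: "trivialises D \<delta> K s" "trivialises D \<delta>' K s'"
    and pq: "p \<in> D" "q \<in> D"
  shows "s p * s' p = s q * s' q"
proof (rule connected_local_const[OF assms(1) pq, of "\<lambda>x. s x * s' x"])
  show "\<forall>x\<in>D. \<forall>\<^sub>F y in at x within D. s x * s' x = s y * s' y"
  proof
    fix x assume x: "x \<in> D"
    have "s x * s' x = s y * s' y" if y: "y \<in> D" "dist x y < min \<delta> \<delta>'" for y
    proof -
      have eq: "s y = s x * K x y" "s' y = s' x * K x y"
        using s x y unfolding trivialises_def by (meson min_less_iff_conj)+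
      have "s x \<in> {1, -1}" "s y \<in> {1, -1}"
        using s(1) x y(1) unfolding trivialises_def by blast+
      then have sq: "s x * s x = 1" "s y * s y = 1" by auto
      have "(s x * s x) * (K x y * K x y) = s y * s y" unfolding eq(1) by (simp only: ac_simps)
      then have kk: "K x y * K x y = 1" unfolding sq by simp
      have "s y * s' y = (s x * s' x) * (K x y * K x y)" unfolding eq by (simp only: ac_simps)
      then show ?thesis unfolding kk by simp
    qed
    moreover have "min \<delta> \<delta>' > 0" using s by (simp add: trivialises_def)
    ultimately show "\<forall>\<^sub>F y in at x within D. s x * s' x = s y * s' y"
      unfolding eventually_at by (metis dist_commute)
  qed
qed

text \<open>The holonomy of \<open>K\<close> along \<open>g\<close>: the sign by which any primitive
  changes from start to end. It is a relation because its existence depends on the hypotheses on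
  \<open>g\<close> and \<open>K\<close>.\<close>

definition path_sign :: "('a::metric_space \<Rightarrow> 'a \<Rightarrow> real) \<Rightarrow> (real \<Rightarrow> 'a) \<Rightarrow> real \<Rightarrow> bool" where
  "path_sign K g t \<longleftrightarrow> (\<exists>s \<delta>. trivialises {0..1} \<delta> (\<lambda>p q. K (g p) (g q)) s \<and> t = s 0 * s 1)"

lemma path_sign_exists:
  assumes "local_cocycle X \<epsilon> K" "path g" "path_image g \<subseteq> X"
  shows "\<exists>t. path_sign K g t"
proof -
  have "\<exists>s \<delta>. trivialises {0..1} \<delta> (\<lambda>p q. K (g p) (g q)) s"
    by (rule local_cocycle_pullback_trivial[OF _ _ _ _ assms(1)])
      (use assms in \<open>auto simp: path_def path_image_def\<close>)
  then show ?thesis unfolding path_sign_def by blast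
qed

lemma path_sign_unique:
  assumes "path_sign K g t" "path_sign K g t'"
  shows "t = t'"
proof -
  obtain s \<delta> where s: "trivialises {0..1} \<delta> (\<lambda>p q. K (g p) (g q)) s" "t = s 0 * s 1"
    using assms(1) unfolding path_sign_def by blast
  obtain s' \<delta>' where s': "trivialises {0..1} \<delta>' (\<lambda>p q. K (g p) (g q)) s'" "t' = s' 0 * s' 1"
    using assms(2) unfolding path_sign_def by blast
  have "s 0 * s' 0 = s 1 * s' 1"
    by (rule trivialisations_proportional[OF _ s(1) s'(1)]) auto
  moreover have "s 0 \<in> {1, -1}" "s 1 \<in> {1, -1}" "s' 0 \<in> {1, -1}" "s' 1 \<in> {1, -1}"
    using s(1) s'(1) by (auto simp: trivialises_def)
  ultimately show ?thesis using s(2) s'(2) by auto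
qed

lemma path_sign_values:
  assumes "path_sign K g t"
  shows "t \<in> {1, -1}"
proof -
  obtain s \<delta> where s: "trivialises {0..1} \<delta> (\<lambda>p q. K (g p) (g q)) s" "t = s 0 * s 1"
    using assms(1) unfolding path_sign_def by blast
  then have "s 0 \<in> {1, -1}" "s 1 \<in> {1, -1}" unfolding trivialises_def by auto
  then show ?thesis using s(2) by auto
qed

text \<open>A primitive along the joined path restricts to primitives along both halves; in the
  product of the two signs the value at 1/2 occurs squared.\<close>

lemma path_sign_join:
  assumes K: "local_cocycle X \<epsilon> K" and g: "path g" "path_image g \<subseteq> X" and h: "path h" "path_image h \<subseteq> X"
    and gh: "pathfinish g = pathstart h" and t: "path_sign K g t" "path_sign K h t'"
  shows "path_sign K (g +++ h) (t * t')"
proof -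
  have "path (g +++ h)" "path_image (g +++ h) \<subseteq> X"
    using g h gh by (auto simp: path_image_join)
  then obtain u where u: "path_sign K (g +++ h) u" using path_sign_exists[OF K] by blast
  then obtain s \<delta> where s: "trivialises {0..1} \<delta> (\<lambda>p q. K ((g +++ h) p) ((g +++ h) q)) s" "u = s 0 * s 1"
    unfolding path_sign_def by blast
  have \<delta>: "\<delta> > 0" using s(1) by (simp add: trivialises_def)
  have s1: "s p \<in> {1, -1}" if "p \<in> {0..1}" for p
    using s(1) that unfolding trivialises_def by blast
  have sK: "s q = s p * K ((g +++ h) p) ((g +++ h) q)" if "p \<in> {0..1}" "q \<in> {0..1}" "dist p q < \<delta>" for p q
    using s(1) that unfolding trivialises_def by blast
  have "trivialises {0..1} \<delta> (\<lambda>p q. K (g p) (g q)) (\<lambda>x. s (x / 2))"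
    unfolding trivialises_def
  proof (intro conjI ballI impI)
    fix p q :: real assume pq: "p \<in> {0..1}" "q \<in> {0..1}" "dist p q < \<delta>"
    have "dist (p / 2) (q / 2) < \<delta>" using pq(3) by (simp add: dist_real_def)
    moreover have "(g +++ h) (p / 2) = g p" "(g +++ h) (q / 2) = g q" using pq by (auto simp: joinpaths_def)
    ultimately show "s (q / 2) = s (p / 2) * K (g p) (g q)" using sK[of "p / 2" "q / 2"] pq by simp
  next
    show "s (p / 2) \<in> {1, -1}" if "p \<in> {0..1}" for p
      using that by (intro s1) auto
  qed (rule \<delta>)
  then have 1: "path_sign K g (s 0 * s (1 / 2))"
    unfolding path_sign_def by (intro exI[of _ "\<lambda>x. s (x / 2)"] exI[of _ \<delta>]) simp
  have "trivialises {0..1} \<delta> (\<lambda>p q. K (h p) (h q)) (\<lambda>x. s ((x + 1) / 2))"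
    unfolding trivialises_def
  proof (intro conjI ballI impI)
    fix p q :: real assume pq: "p \<in> {0..1}" "q \<in> {0..1}" "dist p q < \<delta>"
    have "dist ((p + 1) / 2) ((q + 1) / 2) = dist p q / 2"
      by (simp add: dist_real_def flip: diff_divide_distrib)
    then have "dist ((p + 1) / 2) ((q + 1) / 2) < \<delta>" using pq(3) zero_le_dist[of p q] by linarith
    then have sq: "s ((q + 1) / 2) = s ((p + 1) / 2) * K ((g +++ h) ((p + 1) / 2)) ((g +++ h) ((q + 1) / 2))"
      using pq by (intro sK) auto
    have eq: "(g +++ h) ((x + 1) / 2) = h x" if "x \<in> {0..1}" for x
    proof (cases "x = 0")
      case True
      then show ?thesis using gh by (simp add: joinpaths_def pathstart_def pathfinish_def)
    next
      case False
      then have "\<not> (x + 1) / 2 \<le> 1 / 2" using that by simp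
      moreover have "2 * ((x + 1) / 2) - 1 = x" by (simp add: field_simps)
      ultimately show ?thesis unfolding joinpaths_def by metis
    qed
    show "s ((q + 1) / 2) = s ((p + 1) / 2) * K (h p) (h q)"
      using sq unfolding eq[OF pq(1)] eq[OF pq(2)] .
  next
    show "s ((p + 1) / 2) \<in> {1, -1}" if "p \<in> {0..1}" for p
      using that by (intro s1) auto
  qed (rule \<delta>)
  then have 2: "path_sign K h (s (1 / 2) * s 1)"
    unfolding path_sign_def by (intro exI[of _ "\<lambda>x. s ((x + 1) / 2)"] exI[of _ \<delta>]) simp
  have tt': "t = s 0 * s (1 / 2)" "t' = s (1 / 2) * s 1"
    using path_sign_unique t 1 2 by blast+
  have half: "s (1 / 2) * s (1 / 2) = 1" using s1[of "1/2"] by auto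
  have "t * t' = s 0 * (s (1 / 2) * s (1 / 2)) * s 1" unfolding tt' by (simp only: mult.assoc)
  then have "t * t' = u" unfolding half s(2) by simp
  then show ?thesis using u by simp
qed

text \<open>A primitive on the whole parameter square restricts to both paths. On the two sides
  where the homotopy rests at an endpoint, the pulled back cocycle is 1, so the primitive is
  constant there.\<close>

lemma path_sign_homotopic:
  fixes X :: "'a::real_normed_vector set"
  assumes K: "local_cocycle X \<epsilon> K" and hom: "homotopic_paths X g h"
    and t: "path_sign K g t" "path_sign K h t'"
  shows "t = t'"
proof -
  obtain H where H: "continuous_on ({0..1} \<times> {0..1}) H" "H \<in> ({0..1} \<times> {0..1}) \<rightarrow> X"
    "\<And>x. x \<in> {0..1} \<Longrightarrow> H (0, x) = g x" "\<And>x. x \<in> {0..1} \<Longrightarrow> H (1, x) = h x"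
    and ends: "\<And>y. y \<in> {0..1::real} \<Longrightarrow> H (y, 0) = pathstart g" "\<And>y. y \<in> {0..1::real} \<Longrightarrow> H (y, 1) = pathfinish g"
    using hom unfolding homotopic_paths by (auto simp: pathstart_def pathfinish_def)
  have "\<exists>s \<delta>. trivialises ({0..1::real} \<times> {0..1::real}) \<delta> (\<lambda>p q. K (H p) (H q)) s"
    by (rule local_cocycle_pullback_trivial[OF _ _ H(1) _ K]) (use H(2) in \<open>auto intro: convex_Times compact_Times\<close>)
  then obtain s \<delta> where s: "trivialises ({0..1} \<times> {0..1}) \<delta> (\<lambda>p q. K (H p) (H q)) s" by blast
  have \<delta>: "\<delta> > 0" using s by (simp add: trivialises_def)
  have s1: "s p \<in> {1, -1}" if "p \<in> {0..1} \<times> {0..1}" for p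
    using s that unfolding trivialises_def by blast
  have sK: "s q = s p * K (H p) (H q)"
    if "p \<in> {0..1} \<times> {0..1}" "q \<in> {0..1} \<times> {0..1}" "dist p q < \<delta>" for p q
    using s that unfolding trivialises_def by blast
  have row: "trivialises {0..1} \<delta> (\<lambda>p q. K (H (y, p)) (H (y, q))) (\<lambda>x. s (y, x))" if "y \<in> {0..1}" for y
    unfolding trivialises_def
  proof (intro conjI ballI impI)
    fix p q :: real assume pq: "p \<in> {0..1}" "q \<in> {0..1}" "dist p q < \<delta>"
    then have "dist (y, p) (y, q) < \<delta>" by (simp add: dist_Pair_Pair)
    with pq that show "s (y, q) = s (y, p) * K (H (y, p)) (H (y, q))" by (intro sK) auto
  next
    show "s (y, p) \<in> {1, -1}" if "p \<in> {0..1}" for p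
      using that \<open>y \<in> {0..1}\<close> by (intro s1) auto
  qed (rule \<delta>)
  have "trivialises {0..1} \<delta> (\<lambda>p q. K (g p) (g q)) (\<lambda>x. s (0, x))"
    by (rule trivialises_cong[OF row[of 0]]) (simp_all add: H(3))
  then have "path_sign K g (s (0, 0) * s (0, 1))" unfolding path_sign_def by blast
  moreover have "trivialises {0..1} \<delta> (\<lambda>p q. K (h p) (h q)) (\<lambda>x. s (1, x))"
    by (rule trivialises_cong[OF row[of 1]]) (simp_all add: H(4))
  then have "path_sign K h (s (1, 0) * s (1, 1))" unfolding path_sign_def by blast
  moreover have side: "s (0, x) = s (1, x)"
    if x: "x \<in> {0..1}" and const: "\<And>y. y \<in> {0..1} \<Longrightarrow> H (y, x) = c" for x c
  proof -
    have "c \<in> X" using H(2) const[of 0] x by fastforce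
    then have Kc: "K c c = 1" by (rule local_cocycle_refl[OF K])
    have "trivialises {0..1} \<delta> (\<lambda>_ _. 1) (\<lambda>y. s (y, x))"
      unfolding trivialises_def
    proof (intro conjI ballI impI)
      fix p q :: real assume pq: "p \<in> {0..1}" "q \<in> {0..1}" "dist p q < \<delta>"
      then have "dist (p, x) (q, x) < \<delta>" by (simp add: dist_Pair_Pair)
      then have "s (q, x) = s (p, x) * K (H (p, x)) (H (q, x))" using pq x by (intro sK) auto
      then show "s (q, x) = s (p, x) * 1" unfolding const[OF pq(1)] const[OF pq(2)] Kc .
    next
      show "s (p, x) \<in> {1, -1}" if "p \<in> {0..1}" for p
        using that x by (intro s1) auto
    qed (rule \<delta>)
    moreover have "trivialises {0..1} \<delta> (\<lambda>_ _. 1) (\<lambda>y. 1)" using \<delta> by (simp add: trivialises_def)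
    ultimately have "s (0, x) * 1 = s (1, x) * 1"
      by (rule trivialisations_proportional[rotated]) auto
    then show ?thesis by simp
  qed
  have "s (0, 0) = s (1, 0)" "s (0, 1) = s (1, 1)" using side ends by auto
  ultimately show ?thesis using path_sign_unique t by metis
qed

text \<open>\<open>\<sigma>\<close> is the holonomy along a chosen path from a base point,
  independent of the choice by homotopy. The conclusion is about paths because nearby points of
  \<open>X\<close> need not be joined by a short path in \<open>X\<close>.\<close>

lemma simply_connected_local_cocycle_trivial:
  fixes X :: "'a::real_normed_vector set"
  assumes sc: "simply_connected X" and K: "local_cocycle X \<epsilon> K"
  shows "\<exists>\<sigma>. (\<forall>x\<in>X. \<sigma> x \<in> {1, -1}) \<and>
    (\<forall>g t. path g \<longrightarrow> path_image g \<subseteq> X \<longrightarrow> path_sign K g t \<longrightarrow> \<sigma> (pathfinish g) = \<sigma> (pathstart g) * t)"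
proof (cases "X = {}")
  case True
  then show ?thesis by (auto simp: path_image_def)
next
  case False
  then obtain x0 where x0: "x0 \<in> X" by blast
  have pc: "path_connected X"
    and hom: "\<And>p q. \<lbrakk>path p; path_image p \<subseteq> X; path q; path_image q \<subseteq> X;
      pathstart q = pathstart p; pathfinish q = pathfinish p\<rbrakk> \<Longrightarrow> homotopic_paths X p q"
    using sc unfolding simply_connected_eq_homotopic_paths by blast+
  have "\<exists>g t. path g \<and> path_image g \<subseteq> X \<and> pathstart g = x0 \<and> pathfinish g = x \<and> path_sign K g t"
    if "x \<in> X" for x
    using pc x0 that path_sign_exists[OF K] unfolding path_connected_def by metis
  then obtain \<gamma> \<sigma> where \<gamma>: "\<And>x. x \<in> X \<Longrightarrow> path (\<gamma> x) \<and> path_image (\<gamma> x) \<subseteq> X \<and>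
      pathstart (\<gamma> x) = x0 \<and> pathfinish (\<gamma> x) = x \<and> path_sign K (\<gamma> x) (\<sigma> x)"
    by metis
  have "\<sigma> (pathfinish g) = \<sigma> (pathstart g) * t"
    if g: "path g" "path_image g \<subseteq> X" "path_sign K g t" for g t
  proof -
    have X: "pathstart g \<in> X" "pathfinish g \<in> X" using g(2) by auto
    have "path_sign K (\<gamma> (pathstart g) +++ g) (\<sigma> (pathstart g) * t)"
      using \<gamma>[OF X(1)] g by (intro path_sign_join[OF K]) auto
    moreover have "homotopic_paths X (\<gamma> (pathfinish g)) (\<gamma> (pathstart g) +++ g)"
      using \<gamma>[OF X(1)] \<gamma>[OF X(2)] g by (intro hom) (auto simp: path_image_join)
    ultimately show ?thesis using path_sign_homotopic[OF K] \<gamma>[OF X(2)] by blast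
  qed
  moreover have "\<forall>x\<in>X. \<sigma> x \<in> {1, -1}" using \<gamma> path_sign_values by blast
  ultimately show ?thesis by blast
qed

section \<open>Triangulated spheres\<close>

lemma in_affine_hull_2_midpoint:
  fixes a b :: "'a::real_vector"
  assumes "p \<in> affine hull {a, b}"
  shows "\<exists>t. p = (1/2) *\<^sub>R (a + b) + t *\<^sub>R (b - a)"
proof -
  obtain u v where uv: "p = u *\<^sub>R a + v *\<^sub>R b" "u + v = 1" using assms by (auto simp: affine_hull_2)
  have u: "u = 1 - v" using uv(2) by simp
  have "p = (1/2) *\<^sub>R (a + b) + (v - 1/2) *\<^sub>R (b - a)"
    unfolding uv(1) u by (simp add: algebra_simps flip: scaleR_add_left)
  then show ?thesis by blast
qed

lemma midpoint_combination_zero: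
  fixes a b c :: "'a::real_vector"
  assumes c: "c \<notin> affine hull {a, b}" and "a \<noteq> b"
    and eq: "\<alpha> *\<^sub>R (b - a) + \<beta> *\<^sub>R (c - (1/2) *\<^sub>R (a + b)) = 0"
  shows "\<alpha> = 0 \<and> \<beta> = 0"
proof -
  have "\<beta> = 0"
  proof (rule ccontr)
    assume \<beta>: "\<beta> \<noteq> 0"
    have "\<beta> *\<^sub>R (c - (1/2) *\<^sub>R (a + b)) = - \<alpha> *\<^sub>R (b - a)" using eq by (simp add: add_eq_0_iff)
    then have "(1 / \<beta>) *\<^sub>R \<beta> *\<^sub>R (c - (1/2) *\<^sub>R (a + b)) = (1 / \<beta>) *\<^sub>R (- \<alpha>) *\<^sub>R (b - a)" by simp
    then have "c - (1/2) *\<^sub>R (a + b) = (- \<alpha> / \<beta>) *\<^sub>R (b - a)" using \<beta> by simp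
    then have "c = (1/2) *\<^sub>R (a + b) + (- \<alpha> / \<beta>) *\<^sub>R (b - a)" by (simp add: algebra_simps)
    also have "\<dots> = (1/2 + \<alpha> / \<beta>) *\<^sub>R a + (1/2 - \<alpha> / \<beta>) *\<^sub>R b" by (simp add: algebra_simps)
    finally have "c \<in> affine hull {a, b}" unfolding affine_hull_2 by (simp, metis add_diff_eq diff_add_cancel field_sum_of_halves diff_add_eq)
    then show False using c by simp
  qed
  then show ?thesis using eq \<open>a \<noteq> b\<close> by simp
qed

text \<open>Two triangles already fill a neighbourhood of the midpoint \<open>m\<close> of the edge
  in the surface, by invariance of domain; yet points of the third triangle off the edge converge to
  \<open>m\<close>.\<close>

lemma sphere_no_three_triangles_on_edge:
  fixes X :: "'e::euclidean_space set"
  assumes X: "X homeomorphic sphere (0 :: real^3) 1" and ab: "a \<noteq> b"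
    and c: "\<And>i. i \<in> {1,2,3::nat} \<Longrightarrow> c i \<notin> affine hull {a, b}"
    and TX: "\<And>i. i \<in> {1,2,3} \<Longrightarrow> convex hull {a, b, c i} \<subseteq> X"
    and disj: "\<And>i j. i \<in> {1,2,3} \<Longrightarrow> j \<in> {1,2,3} \<Longrightarrow> i \<noteq> j \<Longrightarrow>
      convex hull {a, b, c i} \<inter> convex hull {a, b, c j} \<subseteq> affine hull {a, b}"
  shows False
proof -
  define m where "m = (1/2) *\<^sub>R (a + b)"
  define T where "T i = convex hull {a, b, c i}" for i
  have zero: "\<alpha> = 0 \<and> \<beta> = 0" if "\<alpha> *\<^sub>R (b - a) + \<beta> *\<^sub>R (c i - m) = 0" "i \<in> {1,2,3}" for \<alpha> \<beta> i
    using midpoint_combination_zero[OF c[OF that(2)] ab] that(1) by (simp add: m_def)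
  have aff: "\<exists>t. p = m + t *\<^sub>R (b - a)" if "p \<in> T i" "p \<in> T j" "i \<in> {1,2,3}" "j \<in> {1,2,3}" "i \<noteq> j" for p i j
    using in_affine_hull_2_midpoint disj[OF that(3-5)] that(1,2) unfolding T_def m_def by blast
  \<comment> \<open>The bounds say that the barycentric coordinates (1 - y)/2 - x, (1 - y)/2 + x and
    y are nonnegative.\<close>
  have inT: "m + x *\<^sub>R (b - a) + y *\<^sub>R (c i - m) \<in> T i" if "\<bar>x\<bar> \<le> (1 - y) / 2" "0 \<le> y" "y \<le> 1" for x y i
  proof -
    have "m + x *\<^sub>R (b - a) + y *\<^sub>R (c i - m) =
        ((1 - y) / 2 - x) *\<^sub>R a + ((1 - y) / 2 + x) *\<^sub>R b + y *\<^sub>R c i"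
      by (simp add: m_def diff_divide_distrib algebra_simps)
    moreover have "0 \<le> (1 - y) / 2 - x" "0 \<le> (1 - y) / 2 + x" using that by linarith+
    moreover have "((1 - y) / 2 - x) + ((1 - y) / 2 + x) + y = 1" by simp
    ultimately show ?thesis unfolding T_def convex_hull_3 using that(2) by blast
  qed
  have flat: "y = 0" if as: "m + x *\<^sub>R (b - a) + y *\<^sub>R (c i - m) \<in> T j" "\<bar>x\<bar> \<le> (1 - y) / 2" "0 \<le> y" "y \<le> 1"
    "i \<in> {1,2,3}" "j \<in> {1,2,3}" "i \<noteq> j" for x y i j
  proof -
    obtain t where "m + x *\<^sub>R (b - a) + y *\<^sub>R (c i - m) = m + t *\<^sub>R (b - a)"
      using aff[OF inT[OF as(2-4)] as(1) as(5-7)] by blast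
    then have "(x - t) *\<^sub>R (b - a) + y *\<^sub>R (c i - m) = 0" by (simp add: algebra_simps)
    then show ?thesis using zero as(5) by blast
  qed

  (* a chart of T 1 \<union> T 2 around the midpoint m of the common edge *)
  define g :: "complex \<Rightarrow> 'e" where
    "g z = m + Re z *\<^sub>R (b - a) + max (Im z) 0 *\<^sub>R (c 1 - m) + max (- Im z) 0 *\<^sub>R (c 2 - m)" for z
  \<comment> \<open>Any small radius serves: for coordinates below 1/8 the condition of
    \<open>inT\<close> holds with room to spare.\<close>
  define U :: "complex set" where "U = ball 0 (1/8)"
  have U: "\<bar>Re z\<bar> < 1/8" "\<bar>Im z\<bar> < 1/8" if "z \<in> U" for z
    using that abs_Re_le_cmod[of z] abs_Im_le_cmod[of z] by (auto simp: U_def)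
  have g_upper: "g z = m + Re z *\<^sub>R (b - a) + Im z *\<^sub>R (c 1 - m)" if "Im z \<ge> 0" for z
    using that by (simp add: g_def max_def)
  have g_lower: "g z = m + Re z *\<^sub>R (b - a) + (- Im z) *\<^sub>R (c 2 - m)" if "Im z \<le> 0" for z
    using that by (simp add: g_def max_def)
  have gT1: "g z \<in> T 1" if "z \<in> U" "Im z \<ge> 0" for z
    unfolding g_upper[OF that(2)] using U[OF that(1)] that(2) by (intro inT) (simp_all add: field_simps)
  have gT2: "g z \<in> T 2" if "z \<in> U" "Im z \<le> 0" for z
    unfolding g_lower[OF that(2)] using U[OF that(1)] that(2) by (intro inT) (simp_all add: field_simps)
  have gU: "g z \<in> T 1 \<union> T 2" if "z \<in> U" for z
    using gT1[OF that] gT2[OF that] by (cases "Im z \<ge> 0") auto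
  have same1: "z = w" if "g z = g w" "Im z \<ge> 0" "Im w \<ge> 0" for z w
  proof -
    have "(Re z - Re w) *\<^sub>R (b - a) + (Im z - Im w) *\<^sub>R (c 1 - m) = 0"
      using that(1) unfolding g_upper[OF that(2)] g_upper[OF that(3)] by (simp add: algebra_simps)
    then have "Re z - Re w = 0 \<and> Im z - Im w = 0" by (rule zero) simp
    then show ?thesis by (simp add: complex_eq_iff)
  qed
  have same2: "z = w" if "g z = g w" "Im z \<le> 0" "Im w \<le> 0" for z w
  proof -
    have "(Re z - Re w) *\<^sub>R (b - a) + (Im w - Im z) *\<^sub>R (c 2 - m) = 0"
      using that(1) unfolding g_lower[OF that(2)] g_lower[OF that(3)] by (simp add: algebra_simps)
    then have "Re z - Re w = 0 \<and> Im w - Im z = 0" by (rule zero) simp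
    then show ?thesis by (simp add: complex_eq_iff)
  qed
  have cross: "z = w" if "g z = g w" "z \<in> U" "w \<in> U" "Im z \<ge> 0" "Im w \<le> 0" for z w
  proof -
    have "m + Re z *\<^sub>R (b - a) + Im z *\<^sub>R (c 1 - m) \<in> T 2"
      using gT2[OF that(3,5)] that(1) g_upper[OF that(4)] by simp
    then have "Im z = 0" by (rule flat) (use U[OF that(2)] that(4) in simp_all)
    then show ?thesis using same2[OF that(1)] that(5) by simp
  qed
  have inj_g: "inj_on g U"
  proof (rule inj_onI)
    fix z w assume "z \<in> U" "w \<in> U" "g z = g w"
    then show "z = w"
      using same1[of z w] same2[of z w] cross[of z w] cross[of w z] by (metis linear)
  qed
  have cont_g: "continuous_on U g" unfolding g_def by (intro continuous_intros)

  \<comment> \<open>The apex \<open>c 3\<close> lies outside the first two triangles, so it can be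
    removed; the sphere without its image is a plane, where invariance of domain applies.\<close>
  have c3: "c 3 \<in> T 3" "c 3 \<in> X" using TX[of 3] by (auto simp: T_def hull_inc)
  have c3_out: "c 3 \<notin> T 1" "c 3 \<notin> T 2"
    using disj[of 3 1] disj[of 3 2] c[of 3] c3(1) by (auto simp: T_def)
  obtain \<phi> \<phi>' where \<phi>: "homeomorphism X (sphere (0 :: real^3) 1) \<phi> \<phi>'"
    using X by (auto simp: homeomorphic_def)
  have "\<phi> (c 3) \<in> sphere 0 1" using \<phi> c3(2) by (auto simp: homeomorphism_def)
  then have "(sphere (0 :: real^3) 1 - {\<phi> (c 3)}) homeomorphic (UNIV :: complex set)"
    by (intro homeomorphic_punctured_sphere_affine) auto
  then obtain k k' where k: "homeomorphism (sphere (0 :: real^3) 1 - {\<phi> (c 3)}) (UNIV :: complex set) k k'"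
    by (auto simp: homeomorphic_def)
  define Y where "Y = X - {c 3}"
  define \<psi> where "\<psi> = k \<circ> \<phi>"
  have inj_\<phi>: "inj_on \<phi> X" using \<phi> by (metis homeomorphism_def inj_on_inverseI)
  have \<phi>Y: "\<phi> ` Y \<subseteq> sphere 0 1 - {\<phi> (c 3)}"
  proof
    fix y assume "y \<in> \<phi> ` Y"
    then obtain x where x: "y = \<phi> x" "x \<in> X" "x \<noteq> c 3" by (auto simp: Y_def)
    then have "\<phi> x \<noteq> \<phi> (c 3)" using inj_\<phi> c3(2) by (auto dest: inj_onD)
    moreover have "\<phi> x \<in> sphere 0 1" using \<phi> x(2) by (auto simp: homeomorphism_def)
    ultimately show "y \<in> sphere 0 1 - {\<phi> (c 3)}" using x(1) by simp
  qed
  have inj_\<psi>: "inj_on \<psi> Y"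
  proof -
    have "inj_on \<phi> Y" using inj_\<phi> by (rule inj_on_subset) (auto simp: Y_def)
    moreover have "inj_on k (sphere 0 1 - {\<phi> (c 3)})" using k by (metis homeomorphism_def inj_on_inverseI)
    ultimately show ?thesis unfolding \<psi>_def using \<phi>Y by (meson comp_inj_on inj_on_subset)
  qed
  have cont_\<psi>: "continuous_on Y \<psi>"
    unfolding \<psi>_def
  proof (rule continuous_on_compose)
    show "continuous_on Y \<phi>" using \<phi> by (auto simp: homeomorphism_def Y_def intro: continuous_on_subset)
    show "continuous_on (\<phi> ` Y) k" using k \<phi>Y by (meson continuous_on_subset homeomorphism_def)
  qed
  have TY: "T 1 \<subseteq> Y" "T 2 \<subseteq> Y" using TX[of 1] TX[of 2] c3_out by (auto simp: Y_def T_def)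
  then have gY: "g ` U \<subseteq> Y" using gU by blast
  have "open ((\<psi> \<circ> g) ` U)"
  proof (rule invariance_of_domain)
    show "continuous_on U (\<psi> \<circ> g)"
      using cont_g cont_\<psi> gY by (meson continuous_on_compose continuous_on_subset)
    show "inj_on (\<psi> \<circ> g) U" using inj_g inj_\<psi> gY by (meson comp_inj_on inj_on_subset)
  qed (simp add: U_def)
  \<comment> \<open>The height starts at 1/2, since height 1 would be the removed apex
    \<open>c 3\<close>.\<close>
  define q where "q n = m + (0::real) *\<^sub>R (b - a) + (1 / real (Suc (Suc n))) *\<^sub>R (c 3 - m)" for n
  have qT: "q n \<in> T 3" for n unfolding q_def by (rule inT) auto
  have qn: "q n \<notin> T 1 \<union> T 2" for n
  proof
    assume "q n \<in> T 1 \<union> T 2"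
    then have "1 / real (Suc (Suc n)) = 0"
      using flat[of 0 "1 / real (Suc (Suc n))" 3 1] flat[of 0 "1 / real (Suc (Suc n))" 3 2]
      unfolding q_def by auto
    then show False by simp
  qed
  have qY: "q n \<in> Y" for n
  proof -
    have "q n \<noteq> c 3"
    proof
      assume "q n = c 3"
      then have "0 *\<^sub>R (b - a) + (1 / real (Suc (Suc n)) - 1) *\<^sub>R (c 3 - m) = 0"
        by (simp add: q_def scaleR_left_diff_distrib eq_diff_eq add.commute)
      then have "1 / real (Suc (Suc n)) - 1 = 0" using zero[of 0 _ 3] by blast
      then show False by simp
    qed
    then show ?thesis using qT[of n] TX[of 3] by (auto simp: Y_def T_def)
  qed
  have "(\<lambda>n. 1 / real (Suc (Suc n))) \<longlonglongrightarrow> 0"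
    using LIMSEQ_Suc[OF LIMSEQ_Suc[OF lim_1_over_n]] by simp
  then have "q \<longlonglongrightarrow> m + 0 *\<^sub>R (b - a) + 0 *\<^sub>R (c 3 - m)"
    unfolding q_def by (intro tendsto_intros)
  moreover have g0: "g 0 = m" by (simp add: g_def)
  ultimately have "q \<longlonglongrightarrow> g 0" by simp
  have 0: "0 \<in> U" by (simp add: U_def)
  then have "g 0 \<in> Y" using gY by blast
  then have lim: "(\<lambda>n. \<psi> (q n)) \<longlonglongrightarrow> \<psi> (g 0)"
    using cont_\<psi> \<open>q \<longlonglongrightarrow> g 0\<close> qY unfolding continuous_on_sequentially o_def by blast
  have "\<psi> (g 0) \<in> (\<psi> \<circ> g) ` U" using 0 by auto
  then have "\<forall>\<^sub>F n in sequentially. \<psi> (q n) \<in> (\<psi> \<circ> g) ` U"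
    by (rule topological_tendstoD[OF lim \<open>open ((\<psi> \<circ> g) ` U)\<close>])
  then obtain n where "\<psi> (q n) \<in> (\<psi> \<circ> g) ` U"
    using eventually_happens' sequentially_bot by blast
  then obtain z where z: "z \<in> U" "\<psi> (q n) = \<psi> (g z)" by auto
  then have "q n = g z" using inj_\<psi> qY gY by (meson image_subset_iff inj_onD)
  then show False using qn gU z(1) by metis
qed

lemma card_triple_Int:
  assumes "x \<noteq> y" "y \<noteq> z" "x \<noteq> z"
  shows "card ({x, y, z} \<inter> D) = of_bool (x \<in> D) + of_bool (y \<in> D) + of_bool (z \<in> D)"
  using assms by (cases "x \<in> D"; cases "y \<in> D"; cases "z \<in> D") simp_all

text \<open>The mod 2 sum of the given faces is adjoined as one more face. It corrects the edges on
  exactly one face, is orthogonal to all cuts as a sum, and only adds a condition on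
  \<open>c\<close>.\<close>

lemma planar_edgesI:
  assumes finE: "finite E" and finI: "finite I" and FE: "\<And>i. i \<in> I \<Longrightarrow> F i \<subseteq> E"
    and le2: "\<And>e. e \<in> E \<Longrightarrow> card {i\<in>I. e \<in> F i} \<le> 2"
    and cyc: "\<And>i S. i \<in> I \<Longrightarrow> even (card (F i \<inter> edge_cut E S))"
    and coc: "\<And>c. \<lbrakk>c \<subseteq> E; \<And>i. i \<in> I \<Longrightarrow> even (card (c \<inter> F i))\<rbrakk> \<Longrightarrow> \<exists>S. c = edge_cut E S"
  shows "planar_edges E"
proof -
  define n where "n = card I"
  obtain f where f: "bij_betw f {0..<n} I" using ex_bij_betw_nat_finite[OF finI] by (auto simp: n_def)
  (* the extra face: the edges lying on exactly one face *)
  define z where "z = {e\<in>E. odd (card {i\<in>I. e \<in> F i})}"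
  define G where "G k = (if k < n then F (f k) else z)" for k
  have fI: "f k \<in> I" if "k < n" for k using f that by (auto simp: bij_betw_def)
  have zcut: "even (card (z \<inter> edge_cut E S))" for S
  proof -
    have finD: "finite (edge_cut E S)" using finE edge_cut_subset finite_subset by metis
    have "even (\<Sum>i\<in>I. card (edge_cut E S \<inter> F i))"
      by (rule dvd_sum) (use cyc in \<open>simp add: Int_commute\<close>)
    then have "even (\<Sum>e\<in>edge_cut E S. card {i\<in>I. e \<in> F i})"
      using sum_card_Int_faces[OF finI finD, of F] by simp
    then have "even (card {e\<in>edge_cut E S. odd (card {i\<in>I. e \<in> F i})})"
      using finD by (simp add: even_sum_iff)
    moreover have "{e\<in>edge_cut E S. odd (card {i\<in>I. e \<in> F i})} = z \<inter> edge_cut E S"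
      by (auto simp: z_def edge_cut_def)
    ultimately show ?thesis by simp
  qed
  have "face_system E {..n} G"
    unfolding face_system_def
  proof (intro conjI ballI allI impI)
    fix k assume "k \<in> {..n}"
    then show "G k \<subseteq> E" using FE[OF fI] by (auto simp: G_def z_def)
    fix S
    show "even (card (G k \<inter> edge_cut E S))" using cyc[OF fI] zcut by (simp add: G_def)
  next
    fix e assume e: "e \<in> E"
    define N where "N = card {i\<in>I. e \<in> F i}"
    have "f ` {k\<in>{0..<n}. e \<in> F (f k)} = {i\<in>I. e \<in> F i}"
      using f by (auto simp: bij_betw_def)
    moreover have "inj_on f {k\<in>{0..<n}. e \<in> F (f k)}"
      using f by (auto simp: bij_betw_def inj_on_def)
    ultimately have N: "card {k\<in>{0..<n}. e \<in> F (f k)} = N" unfolding N_def by (metis card_image)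
    have "{k\<in>{..n}. e \<in> G k} = {k\<in>{0..<n}. e \<in> F (f k)} \<union> (if odd N then {n} else {})"
      using e by (auto simp: G_def z_def N_def)
    then have "card {k\<in>{..n}. e \<in> G k} = N + of_bool (odd N)"
      using N by (auto simp: card_insert_if)
    moreover have "N \<le> 2" using le2[OF e] by (simp add: N_def)
    then have "N = 0 \<or> N = 1 \<or> N = 2" by linarith
    ultimately show "card {k\<in>{..n}. e \<in> G k} \<in> {0, 2}" by auto
  next
    fix c assume c: "c \<subseteq> E" "\<forall>k\<in>{..n}. even (card (c \<inter> G k))"
    have "even (card (c \<inter> F i))" if i: "i \<in> I" for i
    proof -
      have "i \<in> f ` {0..<n}" using f i by (simp add: bij_betw_def)
      then obtain k where "k < n" "i = f k" by auto
      then show ?thesis using c(2)[rule_format, of k] by (simp add: G_def)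
    qed
    then show "\<exists>S. c = edge_cut E S" using coc[OF c(1)] by blast
  qed simp
  then show ?thesis unfolding planar_edges_def by blast
qed

text \<open>Vertices are read off from the singletons of the complex, so no affinely independent
  spanning set has to be chosen.\<close>

definition simplex_vertices :: "'e set set \<Rightarrow> 'e set \<Rightarrow> 'e set" where
  "simplex_vertices C S = {x\<in>S. {x} \<in> C}"

context
  fixes C :: "'e::euclidean_space set set"
  assumes C: "simplicial_complex C"
begin

lemma complex_face: "S \<in> C \<Longrightarrow> F face_of S \<Longrightarrow> F \<in> C"
  using C unfolding simplicial_complex_def by blast

lemma complex_Int_face: "S \<in> C \<Longrightarrow> S' \<in> C \<Longrightarrow> S \<inter> S' face_of S"
  using C unfolding simplicial_complex_def by blast

text \<open>A singleton of \<open>C\<close> inside the simplex meets it in a face and so is an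
  extreme point; conversely extreme points are faces, and \<open>C\<close> contains the faces of its
  members.\<close>

lemma simplex_vertices_hull:
  assumes "convex hull A \<in> C" "\<not> affine_dependent A"
  shows "simplex_vertices C (convex hull A) = A"
proof (intro equalityI subsetI)
  fix x assume "x \<in> simplex_vertices C (convex hull A)"
  then have x: "x \<in> convex hull A" "{x} \<in> C" by (auto simp: simplex_vertices_def)
  have "convex hull A \<inter> {x} face_of convex hull A" by (rule complex_Int_face[OF assms(1) x(2)])
  then have "{x} face_of convex hull A" using x(1) by simp
  then show "x \<in> A"
    by (simp add: face_of_singleton extreme_point_of_convex_hull_affine_independent[OF assms(2)])
next
  fix x assume x: "x \<in> A"
  then have "{x} face_of convex hull A"
    by (simp add: face_of_singleton extreme_point_of_convex_hull_affine_independent[OF assms(2)])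
  then show "x \<in> simplex_vertices C (convex hull A)"
    using complex_face[OF assms(1)] x by (simp add: simplex_vertices_def hull_inc)
qed

lemma complex_simplex:
  assumes "S \<in> C"
  shows "\<not> affine_dependent (simplex_vertices C S)" "S = convex hull (simplex_vertices C S)"
proof -
  obtain n where "n simplex S" using C assms unfolding simplicial_complex_def by blast
  then obtain A where A: "\<not> affine_dependent A" "S = convex hull A" by (auto simp: simplex_def)
  then have "simplex_vertices C S = A" using simplex_vertices_hull assms by simp
  then show "\<not> affine_dependent (simplex_vertices C S)" "S = convex hull (simplex_vertices C S)"
    using A by simp_all
qed

lemma complex_subsimplex:
  assumes "S \<in> C" "A \<subseteq> simplex_vertices C S"
  shows "convex hull A \<in> C" "\<not> affine_dependent A" "simplex_vertices C (convex hull A) = A"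
proof -
  show ind: "\<not> affine_dependent A"
    using complex_simplex(1)[OF assms(1)] assms(2) affine_dependent_subset by blast
  have "convex hull A face_of convex hull (simplex_vertices C S)"
    using assms(2) face_of_convex_hull_affine_independent[OF complex_simplex(1)[OF assms(1)]] by blast
  then show hull: "convex hull A \<in> C"
    using complex_face[OF assms(1)] complex_simplex(2)[OF assms(1)] by simp
  show "simplex_vertices C (convex hull A) = A" by (rule simplex_vertices_hull[OF hull ind])
qed

text \<open>A minimal simplex containing \<open>x\<close> lies in every simplex containing
  \<open>x\<close>, since intersections are faces; any of its vertices will do. It follows that the
  open stars of vertices cover the complex.\<close>

lemma carrier_vertex:
  assumes "x \<in> \<Union>C"
  shows "\<exists>v. {v} \<in> C \<and> (\<forall>S\<in>C. x \<in> S \<longrightarrow> v \<in> S)"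
proof -
  have "finite {S\<in>C. x \<in> S}" using C by (simp add: simplicial_complex_def)
  moreover have "{S\<in>C. x \<in> S} \<noteq> {}" using assms by auto
  ultimately obtain S where S: "S \<in> {S\<in>C. x \<in> S}" "\<forall>S'\<in>{S\<in>C. x \<in> S}. S' \<subseteq> S \<longrightarrow> S' = S"
    using finite_has_minimal by (metis (no_types, lifting))
  have least: "S \<subseteq> S'" if "S' \<in> C" "x \<in> S'" for S'
  proof -
    have "S \<inter> S' \<in> C" using complex_face[OF _ complex_Int_face] S(1) that by blast
    then have "S \<inter> S' = S" using S that by blast
    then show ?thesis by blast
  qed
  have "simplex_vertices C S \<noteq> {}" using complex_simplex(2)[of S] S(1) by auto
  then obtain v where "v \<in> S" "{v} \<in> C" by (auto simp: simplex_vertices_def)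
  then show ?thesis using least by blast
qed

end

lemma simplicial_sphere_planar:
  fixes C :: "'e::euclidean_space set set"
  assumes "sphere_triangulation C V E"
  shows "simple_edges E \<and> \<Union>E \<subseteq> V \<and> planar_edges E"
proof -
  have C: "simplicial_complex C" and X: "\<Union>C homeomorphic sphere (0 :: real^3) 1"
    using assms by (auto simp: sphere_triangulation_def)
  obtain h where h: "bij_betw h V {x. {x} \<in> C}"
    and E: "E = {{v, w} | v w. v \<in> V \<and> w \<in> V \<and> v \<noteq> w \<and> closed_segment (h v) (h w) \<in> C}"
    using assms by (auto simp: sphere_triangulation_def one_skeleton_def)
  note simplex = complex_simplex[OF C] and subsimplex = complex_subsimplex[OF C]
  define vert where "vert = simplex_vertices C"
  have finC: "finite C" using C by (simp add: simplicial_complex_def)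
  have inj: "h v = h w \<longleftrightarrow> v = w" if "v \<in> V" "w \<in> V" for v w
    using h that by (auto simp: bij_betw_def inj_on_def)
  have hC: "{h v} \<in> C" if "v \<in> V" for v using h that by (auto simp: bij_betw_def)
  have surj: "\<exists>v\<in>V. x = h v" if "{x} \<in> C" for x
  proof -
    have "x \<in> h ` V" using h that by (simp add: bij_betw_def)
    then show ?thesis by blast
  qed
  have E_iff: "{v, w} \<in> E \<longleftrightarrow> v \<in> V \<and> w \<in> V \<and> v \<noteq> w \<and> convex hull {h v, h w} \<in> C" for v w
  proof
    assume "{v, w} \<in> E"
    then obtain v' w' where "{v, w} = {v', w'}" "v' \<in> V" "w' \<in> V" "v' \<noteq> w'"
      "closed_segment (h v') (h w') \<in> C" unfolding E by blast
    then show "v \<in> V \<and> w \<in> V \<and> v \<noteq> w \<and> convex hull {h v, h w} \<in> C"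
      by (auto simp: doubleton_eq_iff segment_convex_hull insert_commute)
  next
    assume "v \<in> V \<and> w \<in> V \<and> v \<noteq> w \<and> convex hull {h v, h w} \<in> C"
    then show "{v, w} \<in> E" unfolding E segment_convex_hull by blast
  qed
  have E_pair: "\<exists>v w. e = {v, w} \<and> v \<in> V \<and> w \<in> V \<and> v \<noteq> w" if "e \<in> E" for e
    using that unfolding E by blast
  have simple: "simple_edges E"
    unfolding simple_edges_def
  proof (intro conjI ballI)
    have "finite V"
    proof -
      have "inj_on (\<lambda>x. {x}) {x. {x} \<in> C}" by (simp add: inj_on_def)
      then have "finite {x. {x} \<in> C}" by (rule inj_on_finite[OF _ _ finC]) auto
      then show ?thesis using h bij_betw_finite by blast
    qed
    moreover have "E \<subseteq> Pow V" unfolding E by auto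
    ultimately show "finite E" by (meson finite_Pow_iff finite_subset)
    fix e assume "e \<in> E"
    then show "card e = 2" using E_pair by fastforce
  qed

  \<comment> \<open>Triangles as faces\<close>
  define I where "I = {T\<in>C. card (vert T) = 3}"
  define F where "F T = {e\<in>E. h ` e \<subseteq> T}" for T
  have triangle: "F T = {{u, v}, {v, w}, {u, w}}"
    if T: "T \<in> C" "vert T = {h u, h v, h w}" and V: "u \<in> V" "v \<in> V" "w \<in> V"
      and ne: "u \<noteq> v" "v \<noteq> w" "u \<noteq> w" for T u v w
  proof (intro equalityI subsetI)
    fix e assume "e \<in> F T"
    then have e: "e \<in> E" "h ` e \<subseteq> T" by (auto simp: F_def)
    obtain x y where xy: "e = {x, y}" "x \<in> V" "y \<in> V" "x \<noteq> y" using E_pair[OF e(1)] by blast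
    have "h x \<in> vert T" "h y \<in> vert T"
      using e(2) hC xy by (auto simp: vert_def simplex_vertices_def)
    then have "x \<in> {u, v, w}" "y \<in> {u, v, w}" using T(2) inj xy(2,3) V by auto
    then show "e \<in> {{u, v}, {v, w}, {u, w}}" using xy(1,4) by (auto simp: doubleton_eq_iff)
  next
    have edge: "{x, y} \<in> F T" if xy: "x \<in> V" "y \<in> V" "x \<noteq> y" "h x \<in> vert T" "h y \<in> vert T" for x y
    proof -
      have "convex hull {h x, h y} \<in> C" using subsimplex(1)[OF T(1)] xy(4,5) by (simp add: vert_def)
      moreover have "h x \<in> T" "h y \<in> T" using xy(4,5) by (auto simp: vert_def simplex_vertices_def)
      ultimately show ?thesis using xy(1-3) by (simp add: F_def E_iff)
    qed
    fix e assume "e \<in> {{u, v}, {v, w}, {u, w}}"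
    then show "e \<in> F T" using edge[of u v] edge[of v w] edge[of u w] V ne T(2) by auto
  qed
  have triangleE: "\<exists>u v w. vert T = {h u, h v, h w} \<and> u \<in> V \<and> v \<in> V \<and> w \<in> V \<and>
      u \<noteq> v \<and> v \<noteq> w \<and> u \<noteq> w" if T: "T \<in> I" for T
  proof -
    obtain x y z where xyz: "vert T = {x, y, z}" "x \<noteq> y" "y \<noteq> z" "x \<noteq> z"
      using T unfolding I_def card_3_iff by blast
    have "{x} \<in> C" "{y} \<in> C" "{z} \<in> C"
      using xyz(1) unfolding vert_def simplex_vertices_def by blast+
    then obtain u v w where "u \<in> V" "v \<in> V" "w \<in> V" "x = h u" "y = h v" "z = h w"
      using surj by metis
    then show ?thesis using xyz by blast
  qed

  have "planar_edges E"
  proof (rule planar_edgesI)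
    show "finite E" using simple by (simp add: simple_edges_def)
    show "finite I" using finC by (simp add: I_def)
    show "F T \<subseteq> E" for T by (auto simp: F_def)
  next
    fix T S assume T: "T \<in> I"
    obtain u v w where t: "vert T = {h u, h v, h w}" "u \<in> V" "v \<in> V" "w \<in> V"
      "u \<noteq> v" "v \<noteq> w" "u \<noteq> w" using triangleE[OF T] by blast
    have TC: "T \<in> C" using T by (simp add: I_def)
    have FT: "F T = {{u, v}, {v, w}, {u, w}}" by (rule triangle[OF TC t])
    have in_cut: "e \<in> edge_cut E S \<longleftrightarrow> odd (card (e \<inter> S))" if "e \<in> F T" for e
      using that by (auto simp: edge_cut_def F_def)
    have odd: "odd (card ({x, y} \<inter> S)) \<longleftrightarrow> (x \<in> S) \<noteq> (y \<in> S)" if "x \<noteq> y" for x y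
      using that by (cases "x \<in> S"; cases "y \<in> S") simp_all
    have "{u, v} \<noteq> {v, w}" "{v, w} \<noteq> {u, w}" "{u, v} \<noteq> {u, w}"
      using t by (auto simp: doubleton_eq_iff)
    then have "card (F T \<inter> edge_cut E S) =
        of_bool ({u, v} \<in> edge_cut E S) + of_bool ({v, w} \<in> edge_cut E S) + of_bool ({u, w} \<in> edge_cut E S)"
      unfolding FT by (rule card_triple_Int)
    then show "even (card (F T \<inter> edge_cut E S))"
      using in_cut[of "{u, v}"] in_cut[of "{v, w}"] in_cut[of "{u, w}"] odd t(5-7)
      by (cases "u \<in> S"; cases "v \<in> S"; cases "w \<in> S") (simp_all add: FT)
  next

    \<comment> \<open>At most two triangles on an edge\<close>
    fix e assume e: "e \<in> E"
    show "card {T\<in>I. e \<in> F T} \<le> 2"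
    proof (rule ccontr)
      assume "\<not> ?thesis"
      then have "3 \<le> card {T\<in>I. e \<in> F T}" by simp
      then obtain TT where TT: "TT \<subseteq> {T\<in>I. e \<in> F T}" "card TT = 3" "finite TT"
        by (rule obtain_subset_with_card_n)
      then obtain T1 T2 T3 where T123: "TT = {T1, T2, T3}" "T1 \<noteq> T2" "T2 \<noteq> T3" "T1 \<noteq> T3"
        unfolding card_3_iff by blast
      define T where "T i = (if i = 1 then T1 else if i = 2 then T2 else T3)" for i :: nat
      have T: "T i \<in> I" "e \<in> F (T i)" for i
        using TT(1) T123(1) by (auto simp: T_def)
      have T_ne: "T i \<noteq> T j" if "i \<in> {1,2,3}" "j \<in> {1,2,3}" "i \<noteq> j" for i j
        using that T123(2-4) by (auto simp: T_def)
      obtain v w where vw: "e = {v, w}" "v \<in> V" "w \<in> V" "v \<noteq> w" using E_pair[OF e] by blast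
      define a where "a = h v"
      define b where "b = h w"
      have ab: "a \<noteq> b" using vw inj by (simp add: a_def b_def)
      have TC: "T i \<in> C" for i using T(1) by (simp add: I_def)
      have "\<exists>c. vert (T i) = {a, b, c} \<and> c \<noteq> a \<and> c \<noteq> b" for i
      proof -
        have "{a, b} \<subseteq> vert (T i)"
          using T(2)[of i] vw hC by (auto simp: F_def vert_def simplex_vertices_def a_def b_def)
        moreover have card3: "card (vert (T i)) = 3" using T(1)[of i] by (simp add: I_def)
        ultimately have "card (vert (T i) - {a, b}) = 1"
          using ab by (subst card_Diff_subset) auto
        then obtain c where "vert (T i) - {a, b} = {c}" by (auto simp: card_1_singleton_iff)
        then have "vert (T i) = {a, b, c}" "c \<noteq> a" "c \<noteq> b" using \<open>{a, b} \<subseteq> vert (T i)\<close> by auto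
        then show ?thesis by blast
      qed
      then obtain c where c: "\<And>i. vert (T i) = {a, b, c i}" "\<And>i. c i \<noteq> a" "\<And>i. c i \<noteq> b" by metis
      have hull: "T i = convex hull {a, b, c i}" for i
        using simplex(2)[OF TC[of i]] c(1)[of i] by (simp add: vert_def)
      have ind: "\<not> affine_dependent {a, b, c i}" for i
        using simplex(1)[OF TC[of i]] c(1)[of i] by (simp add: vert_def)
      show False
      proof (rule sphere_no_three_triangles_on_edge[OF X ab])
        fix i :: nat
        have "{a, b, c i} - {c i} = {a, b}" using c(2,3)[of i] by auto
        then show "c i \<notin> affine hull {a, b}" using ind[of i] unfolding affine_dependent_def by auto
        show "convex hull {a, b, c i} \<subseteq> \<Union>C" using TC[of i] unfolding hull by blast
      next
        fix i j :: nat assume ij: "i \<in> {1,2,3}" "j \<in> {1,2,3}" "i \<noteq> j"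
        \<comment> \<open>The common face is spanned by vertices of \<open>T i\<close>. If
          \<open>c i\<close> were one of them, the two triangles would have the same vertices and
          coincide.\<close>
        have "T i \<inter> T j face_of T i" by (rule complex_Int_face[OF C TC TC])
        then obtain A where A: "A \<subseteq> {a, b, c i}" "T i \<inter> T j = convex hull A"
          using face_of_convex_hull_affine_independent[OF ind] hull by metis
        have "c i \<notin> A"
        proof
          assume "c i \<in> A"
          then have "c i \<in> T j" using A(2) hull_inc by fastforce
          moreover have "c i \<in> vert (T i)" by (simp add: c(1))
          ultimately have "c i \<in> vert (T j)" by (simp add: vert_def simplex_vertices_def)
          then have "c i = c j" using c(2,3)[of i] by (simp add: c(1))
          then have "T i = T j" by (simp add: hull)
          then show False using T_ne[OF ij] by simp
        qed
        then have "A \<subseteq> {a, b}" using A(1) by auto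
        then have "convex hull A \<subseteq> affine hull {a, b}"
          by (meson convex_hull_subset_affine_hull hull_mono order_trans)
        then show "convex hull {a, b, c i} \<inter> convex hull {a, b, c j} \<subseteq> affine hull {a, b}"
          using A(2) by (simp add: hull)
      qed
    qed
  next

    \<comment> \<open>Cocycles are cuts\<close>
    fix c assume cE: "c \<subseteq> E" and coc: "\<And>T. T \<in> I \<Longrightarrow> even (card (c \<inter> F T))"
    define g where "g = inv_into V h"
    have g: "g (h v) = v" if "v \<in> V" for v
      using h that by (simp add: g_def bij_betw_def inv_into_f_f)
    have gV: "g x \<in> V" "h (g x) = x" if "{x} \<in> C" for x using surj[OF that] g by auto
    define \<kappa> :: "'e \<Rightarrow> 'e \<Rightarrow> real" where "\<kappa> x y = (if {g x, g y} \<in> c then - 1 else 1)" for x y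
    \<comment> \<open>Three distinct vertices of a simplex span a triangle of \<open>I\<close>,
      where evenness of \<open>c\<close> is this identity; coinciding vertices reduce to
      \<open>loop\<close>, \<open>sym\<close> and \<open>sq\<close>.\<close>
    have \<kappa>: "\<kappa> x y * \<kappa> y z = \<kappa> x z"
      if S: "S \<in> C" and xyz: "x \<in> vert S" "y \<in> vert S" "z \<in> vert S" for S x y z
    proof -
      have vC: "{x} \<in> C" "{y} \<in> C" "{z} \<in> C"
        using xyz by (auto simp: vert_def simplex_vertices_def)
      have loop: "\<kappa> t t = 1" for t
      proof -
        have "{g t, g t} \<notin> E" using E_iff by blast
        then show ?thesis using cE by (auto simp: \<kappa>_def)
      qed
      have sym: "\<kappa> s t = \<kappa> t s" for s t by (simp add: \<kappa>_def insert_commute)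
      have sq: "\<kappa> s t * \<kappa> s t = 1" for s t by (simp add: \<kappa>_def)
      show ?thesis
      proof (cases "x = y \<or> y = z \<or> x = z")
        case True
        then show ?thesis using loop sq sym by (metis mult.left_neutral mult.right_neutral)
      next
        case False
        define T where "T = convex hull {x, y, z}"
        have T: "T \<in> C" "vert T = {x, y, z}"
          using subsimplex(1,3)[OF S, of "{x, y, z}"] xyz by (auto simp: T_def vert_def)
        then have TI: "T \<in> I" using False by (simp add: I_def)
        have gne: "g x \<noteq> g y" "g y \<noteq> g z" "g x \<noteq> g z" using False gV vC by metis+
        have FT: "F T = {{g x, g y}, {g y, g z}, {g x, g z}}"
          by (rule triangle[OF T(1)]) (use T(2) gV vC gne in simp_all)
        have "{g x, g y} \<noteq> {g y, g z}" "{g y, g z} \<noteq> {g x, g z}" "{g x, g y} \<noteq> {g x, g z}"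
          using gne by (auto simp: doubleton_eq_iff)
        then have "card (F T \<inter> c) =
            of_bool ({g x, g y} \<in> c) + of_bool ({g y, g z} \<in> c) + of_bool ({g x, g z} \<in> c)"
          unfolding FT by (rule card_triple_Int)
        moreover have "even (card (F T \<inter> c))" using coc[OF TI] by (simp add: Int_commute)
        ultimately show ?thesis
          by (cases "{g x, g y} \<in> c"; cases "{g y, g z} \<in> c"; cases "{g x, g z} \<in> c")
            (simp_all add: \<kappa>_def)
      qed
    qed
    have \<kappa>1: "\<kappa> x y \<in> {1, -1}" for x y by (simp add: \<kappa>_def)

    \<comment> \<open>The open star of \<open>v\<close>, enlarged by the outside of the complex, so
      that it is open in the ambient space.\<close>
    define star where "star v = - \<Union>{S\<in>C. v \<notin> S}" for v
    have comp: "compact S" if "S \<in> C" for S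
      using C that compact_simplex unfolding simplicial_complex_def by blast
    have op: "open (star v)" for v
      unfolding star_def using finC comp by (intro open_Compl closed_Union) (auto intro: compact_imp_closed)
    have cpt: "compact (\<Union>C)"
      by (rule compact_Union[OF finC]) (rule comp)
    have cover: "\<Union>C \<subseteq> \<Union>(star ` {v. {v} \<in> C})"
    proof
      fix x assume "x \<in> \<Union>C"
      then obtain v where "{v} \<in> C" "\<forall>S\<in>C. x \<in> S \<longrightarrow> v \<in> S" using carrier_vertex[OF C] by blast
      then show "x \<in> \<Union>(star ` {v. {v} \<in> C})" by (auto simp: star_def)
    qed
    \<comment> \<open>A Lebesgue number of the cover by stars.\<close>
    obtain \<epsilon> where \<epsilon>: "0 < \<epsilon>" "\<And>x. x \<in> \<Union>C \<Longrightarrow> \<exists>G\<in>star ` {v. {v} \<in> C}. ball x \<epsilon> \<subseteq> G"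
      by (rule Heine_Borel_lemma[OF cpt cover]) (use op in blast)+
    then have "\<exists>v. {v} \<in> C \<and> ball x \<epsilon> \<subseteq> star v" if "x \<in> \<Union>C" for x using that by blast
    (* L is a simplicial approximation of the identity *)
    then obtain L where L: "\<And>x. x \<in> \<Union>C \<Longrightarrow> {L x} \<in> C \<and> ball x \<epsilon> \<subseteq> star (L x)" by metis
    \<comment> \<open>As \<open>x\<close> lies in the ball around \<open>y\<close>, it lies in the
      star of \<open>L y\<close>, so every simplex through \<open>x\<close> contains
      \<open>L y\<close>. Hence points close to \<open>x\<close> are all sent to vertices of one
      simplex.\<close>
    have L_in: "L y \<in> vert S" if "y \<in> \<Union>C" "S \<in> C" "x \<in> S" "dist x y < \<epsilon>" for x y S
    proof -
      have "x \<in> star (L y)" using L[OF that(1)] that(4) by (auto simp: dist_commute)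
      then have "L y \<in> S" using that(2,3) by (auto simp: star_def)
      then show ?thesis using L[OF that(1)] by (simp add: vert_def simplex_vertices_def)
    qed
    define K where "K x y = \<kappa> (L x) (L y)" for x y
    have K: "local_cocycle (\<Union>C) \<epsilon> K"
      unfolding local_cocycle_def
    proof (intro conjI ballI impI)
      fix x y z assume X: "x \<in> \<Union>C" "y \<in> \<Union>C" "z \<in> \<Union>C" and d: "dist x y < \<epsilon>" "dist x z < \<epsilon>"
      obtain S where "S \<in> C" "x \<in> S" using X(1) by blast
      then show "K x y * K y z = K x z"
        unfolding K_def using \<kappa>[of S] L_in[of _ S x] X d \<epsilon>(1) by simp
    qed (use \<epsilon>(1) \<kappa>1 in \<open>auto simp: K_def\<close>)
    have "simply_connected (sphere (0 :: real^3) 1)" by (rule simply_connected_sphere) simp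
    then have "simply_connected (\<Union>C)"
      using homeomorphic_simply_connected X homeomorphic_sym by blast
    then obtain \<sigma> where \<sigma>1: "\<And>x. x \<in> \<Union>C \<Longrightarrow> \<sigma> x \<in> {1, -1}"
      and \<sigma>: "\<And>g t. \<lbrakk>path g; path_image g \<subseteq> \<Union>C; path_sign K g t\<rbrakk> \<Longrightarrow>
        \<sigma> (pathfinish g) = \<sigma> (pathstart g) * t"
      using simply_connected_local_cocycle_trivial[OF _ K] by blast
    have edge: "\<sigma> (h w) = \<sigma> (h v) * \<kappa> (h v) (h w)" if vw: "{v, w} \<in> E" for v w
    proof -
      define S where "S = convex hull {h v, h w}"
      have S: "S \<in> C" "v \<in> V" "w \<in> V" using vw E_iff by (auto simp: S_def)
      have LS: "L x \<in> vert S" if "x \<in> S" for x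
        using L_in[OF _ S(1) that, of x] S(1) that \<epsilon>(1) by auto
      have Lv: "L (h u) = h u" if "u \<in> V" for u
      proof -
        have "L (h u) \<in> vert {h u}" using L_in[OF _ hC[OF that], of "h u" "h u"] hC[OF that] \<epsilon>(1) by auto
        then show ?thesis by (simp add: vert_def simplex_vertices_def)
      qed
      have hS: "h v \<in> S" "h w \<in> S" by (auto simp: S_def hull_inc)
      define p where "p = linepath (h v) (h w)"
      have p: "path p" "path_image p = S" "p 0 = h v" "p 1 = h w"
        by (simp_all add: p_def S_def segment_convex_hull linepath_0' linepath_1')
      have pS: "p t \<in> S" if "t \<in> {0..1}" for t using p(2) that by (auto simp: path_image_def)
      \<comment> \<open>Along the edge \<open>L\<close> takes only vertices of \<open>S\<close> as
        values, so the cocycle identity holds for all pairs of parameters; the scale 1 is an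
        arbitrary positive number.\<close>
      have "trivialises {0..1} 1 (\<lambda>s t. K (p s) (p t)) (\<lambda>t. \<kappa> (h v) (L (p t)))"
        unfolding trivialises_def
      proof (intro conjI ballI impI)
        fix s t :: real assume st: "s \<in> {0..1}" "t \<in> {0..1}"
        have "L (h v) \<in> vert S" by (rule LS[OF hS(1)])
        then show "\<kappa> (h v) (L (p t)) = \<kappa> (h v) (L (p s)) * K (p s) (p t)"
          unfolding K_def Lv[OF S(2)] using \<kappa>[OF S(1) _ LS[OF pS[OF st(1)]] LS[OF pS[OF st(2)]]] by simp
      qed (use \<kappa>1 in simp_all)
      then have "path_sign K p (\<kappa> (h v) (L (p 0)) * \<kappa> (h v) (L (p 1)))"
        unfolding path_sign_def by blast
      moreover have "\<kappa> (h v) (L (p 0)) * \<kappa> (h v) (L (p 1)) = \<kappa> (h v) (h w)"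
        unfolding p(3,4) Lv[OF S(2)] Lv[OF S(3)]
        by (rule \<kappa>[OF S(1)]) (use LS[OF hS(1)] LS[OF hS(2)] Lv S in simp_all)
      ultimately show ?thesis
        using \<sigma>[OF p(1), of "\<kappa> (h v) (h w)"] p S(1) by (auto simp: pathstart_def pathfinish_def)
    qed
    \<comment> \<open>By \<open>edge\<close>, the sign \<open>\<sigma>\<close> changes along an edge
      exactly when the edge is in \<open>c\<close>, so one sign class is a side of the cut.\<close>
    have "c = edge_cut E {v. \<sigma> (h v) = -1}"
    proof -
      have "e \<in> c \<longleftrightarrow> odd (card (e \<inter> {v. \<sigma> (h v) = -1}))" if e: "e \<in> E" for e
      proof -
        obtain v w where vw: "e = {v, w}" "v \<in> V" "w \<in> V" "v \<noteq> w" using E_pair[OF e] by blast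
        have \<sigma>vw: "\<sigma> (h v) \<in> {1, -1}" "\<sigma> (h w) \<in> {1, -1}" using \<sigma>1 hC vw by blast+
        have eq: "\<sigma> (h w) = \<sigma> (h v) * (if e \<in> c then -1 else 1)"
          using edge[of v w] e vw g by (simp add: \<kappa>_def)
        have "odd (card (e \<inter> {v. \<sigma> (h v) = -1})) \<longleftrightarrow> (\<sigma> (h v) = -1) \<noteq> (\<sigma> (h w) = -1)"
          unfolding vw(1) using vw(4)
          by (cases "\<sigma> (h v) = -1"; cases "\<sigma> (h w) = -1") simp_all
        then show ?thesis using eq \<sigma>vw by (auto split: if_splits)
      qed
      then show ?thesis using cE by (auto simp: edge_cut_def)
    qed
    then show "\<exists>S. c = edge_cut E S" by blast
  qed
  moreover have "\<Union>E \<subseteq> V" unfolding E by auto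
  ultimately show ?thesis using simple by blast
qed

theorem theorem6p3:
  fixes b :: "nat \<Rightarrow> 'x::real_normed_vector"
    and C :: "'e::euclidean_space set set"
    and V :: "'v set" and E :: "'v set set"
  assumes "dim (UNIV :: 'x set) = 3"
    and "smooth_space TYPE('x)"
    and "strictly_convex_space TYPE('x)"
    and "basis_family b"
    and "sphere_triangulation C V E"
  shows "graph_independent b V E"
proof -
  have E: "simple_edges E" "\<Union>E \<subseteq> V" "planar_edges E"
    using simplicial_sphere_planar[OF assms(5)] by auto
  obtain p where "independent_placement b E p"
    using planar_edges_independent_placement[OF assms(1-4) E(1,3)] by blast
  then show ?thesis by (rule graph_independent_if_independent_placement[OF assms(2) E(1,2)])
qed

end
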